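(* Let $p(x)\in\mathbb{Z}[x]$ be a polynomial of degree at least $2$, and let $x_n=p(n)$ for $n\ge 1$. Then there exists a constant $c>0$ such that for Lebesgue-almost all $\alpha\in[0,1]$ the number variance of $(\alpha x_n)_{n\ge1}$ satisfies $$V(N,S,\alpha)=NS+o(NS)$$ uniformly throughout the range $0\le S\le (\log N)^{-c}$, as $N\to\infty$; that is, $\sup_{0<S\le(\log N)^{-c}} \frac{|V(N,S,\alpha)-NS|}{NS}\to 0$ as $N\to\infty$.
   Context: For a sequence of integers $(x_n)_{n\ge1}$, $\alpha\in\mathbb{R}$, $0\le S\le1$ and $y\in[0,1]$, let $$S_N(S,y)=\sum_{n=1}^N\sum_{j\in\mathbb{Z}}\mathbf{1}_{[-S/2,S/2)}(\alpha x_n-y+j)$$ be the number of points $\alpha x_n \bmod 1$, $1\le n\le N$, in an interval of length $S$ around $y$. The number variance is $V(N,S,\alpha)=\int_0^1 S_N(S,y)^2\,dy-N^2S^2$. *)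

theory Defs
  imports "HOL-Analysis.Analysis" "HOL-Computational_Algebra.Polynomial"
begin

text \<open>For fixed \<open>n\<close> only finitely many \<open>j\<close> contribute to the sum over \<open>\<int>\<close>.
  The intended range is \<open>0 \<le> S \<le> 1\<close>, \<open>0 \<le> y \<le> 1\<close>.\<close>

definition count_near :: "(nat \<Rightarrow> int) \<Rightarrow> real \<Rightarrow> nat \<Rightarrow> real \<Rightarrow> real \<Rightarrow> real" where
  "count_near x \<alpha> N S y =
    (\<Sum>n=1..N. \<Sum>\<^sub>\<infinity>j\<in>(UNIV :: int set).
      indicator {- S / 2 ..< S / 2} (\<alpha> * real_of_int (x n) - y + real_of_int j))"

definition number_variance :: "(nat \<Rightarrow> int) \<Rightarrow> nat \<Rightarrow> real \<Rightarrow> real \<Rightarrow> real" where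
  "number_variance x N S \<alpha> =
    (LINT y:{0..1}|lborel. (count_near x \<alpha> N S y)\<^sup>2) - (real N)\<^sup>2 * S\<^sup>2"

end

theory Submission
  imports Defs "HOL-Computational_Algebra.Squarefree"
begin

text \<open>
  Put \<open>\<phi>\<^sub>s(u) = \<lfloor>u + s\<rfloor> - \<lfloor>u - s\<rfloor> - 2s\<close>. Then
  \<open>V(N, S, \<alpha>) = \<Sum>\<^sub>n\<^sub>,\<^sub>m \<integral>\<^sub>0\<^sup>S \<phi>\<^sub>s(\<alpha>(x\<^sub>n - x\<^sub>m)) ds\<close>, the diagonal contributes \<open>N(S - S\<^sup>2)\<close>, and
  \<open>x\<^sub>n = x\<^sub>m\<close> for only boundedly many pairs \<open>m < n\<close>. For nonzero integers \<open>v, w\<close> the functions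
  \<open>\<phi>\<^sub>s(\<alpha>v)\<close> and \<open>\<phi>\<^sub>s(\<alpha>w)\<close> of \<open>\<alpha>\<close> have correlation \<open>O(s gcd(v, w) / max(|v|, |w|))\<close>.

  By Schur's test the sum of \<open>gcd(v, w) / max(|v|, |w|)\<close> over all differences
  \<open>v = p(n) - p(m)\<close>, \<open>m < n < M\<close>, is \<open>O(log M)\<close> times \<open>\<Sum> r(v) \<tau>(v)\<close>, where the number \<open>r(v)\<close> of
  representations of \<open>v\<close> is \<open>O(\<tau>(v))\<close> because \<open>n - m\<close> divides \<open>v\<close>. The second moment
  \<open>\<Sum> \<tau>(p(n) - p(m))\<^sup>2\<close> is \<open>O(M\<^sup>2 (log M)\<^sup>E)\<close>: \<open>\<tau>(v)\<close> is controlled by a squarefree divisor of \<open>v\<close>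
  below \<open>M\<close> or by a \<open>u\<close> such that a high power of \<open>u\<close> divides \<open>v\<close>, and congruences
  \<open>p(n) \<equiv> c\<close> to such moduli have few solutions.

  Hence \<open>P\<^sub>N(s, \<alpha>) = \<Sum> \<phi>\<^sub>s(\<alpha>(x\<^sub>n - x\<^sub>m))\<close> over \<open>m < n \<le> N\<close> has mean square \<open>O(s N\<^sup>2 (log N)\<^sup>E)\<close>, and
  by the Rademacher--Menshov inequality so does its maximum over \<open>N < 2\<^sup>k\<close>, up to powers of \<open>k\<close>.
  Since \<open>\<integral>\<^sub>0\<^sup>S P\<^sup>2 ds \<le> S \<integral>\<^sub>0\<^sup>T P\<^sup>2 ds / s\<close> for \<open>S \<le> T\<close>, the integral over \<open>(0, T]\<close> with
  \<open>T = (4/k)\<^sup>c\<close> controls all \<open>S \<le> T\<close> at once, and its mean is summable over \<open>k\<close> after division by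
  \<open>4\<^sup>k\<close>.
\<close>

section \<open>Divisor counts\<close>

definition divisor_count :: "nat \<Rightarrow> nat" where
  "divisor_count n = card {d. d dvd n}"

lemma divisor_count_pos: "n > 0 \<Longrightarrow> divisor_count n \<ge> 1"
  unfolding divisor_count_def
  using card_gt_0_iff[of "{d. d dvd n}"] by (auto simp: Suc_le_eq intro: exI[of _ 1])

text \<open>A divisor of a product splits into divisors of the factors. Submultiplicativity holds
  without coprimality, which matters because the factors met below may share primes.\<close>

lemma divisor_count_mult_le:
  assumes "a > 0" "b > 0"
  shows "divisor_count (a * b) \<le> divisor_count a * divisor_count b"
proof -
  have sub: "{d. d dvd a * b} \<subseteq> (\<lambda>(x, y). x * y) ` ({d. d dvd a} \<times> {d. d dvd b})"
  proof
    fix d assume "d \<in> {d. d dvd a * b}"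
    then obtain x y where "d = x * y" "x dvd a" "y dvd b"
      using division_decomp by blast
    then show "d \<in> (\<lambda>(x, y). x * y) ` ({d. d dvd a} \<times> {d. d dvd b})" by auto
  qed
  have fin: "finite ({d. d dvd a} \<times> {d. d dvd b})"
    using assms by (intro finite_cartesian_product) auto
  have "divisor_count (a * b) \<le> card ((\<lambda>(x, y). x * y) ` ({d. d dvd a} \<times> {d. d dvd b}))"
    unfolding divisor_count_def by (intro card_mono sub finite_imageI fin)
  also have "\<dots> \<le> card ({d. d dvd a} \<times> {d. d dvd b})"
    by (rule card_image_le[OF fin])
  finally show ?thesis
    by (simp add: divisor_count_def card_cartesian_product)
qed

lemma divisor_count_prime_mult:
  assumes "prime q" "\<not> q dvd a" "a > 0"
  shows "divisor_count (q * a) = 2 * divisor_count a"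
proof -
  have eq: "{d. d dvd q * a} = {d. d dvd a} \<union> (\<lambda>d. q * d) ` {d. d dvd a}"
  proof (intro equalityI subsetI)
    fix d assume "d \<in> {d. d dvd q * a}"
    then obtain x y where xy: "d = x * y" "x dvd q" "y dvd a"
      using division_decomp by blast
    then have "x = 1 \<or> x = q" using assms(1) by (simp add: prime_nat_iff)
    then show "d \<in> {d. d dvd a} \<union> (\<lambda>d. q * d) ` {d. d dvd a}" using xy by auto
  qed auto
  have disj: "{d. d dvd a} \<inter> (\<lambda>d. q * d) ` {d. d dvd a} = {}"
    using assms(2) by (auto dest: dvd_mult_left)
  have inj: "inj_on (\<lambda>d. q * d) {d. d dvd a}"
    using assms(1) by (auto simp: inj_on_def prime_gt_0_nat)
  show ?thesis
    unfolding divisor_count_def eq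
    using assms(3) by (subst card_Un_disjoint) (auto simp: disj card_image[OF inj])
qed

section \<open>Small divisors that control the divisor count\<close>

lemma squarefree_nat_induct [consumes 1, case_names one prime]:
  assumes "squarefree (n :: nat)"
    and "P 1"
    and "\<And>q t. prime q \<Longrightarrow> \<not> q dvd t \<Longrightarrow> squarefree t \<Longrightarrow> P t \<Longrightarrow> P (q * t)"
  shows "P n"
  using assms(1)
proof (induction n rule: less_induct)
  case (less n)
  have n0: "n > 0" using less.prems by (cases n) auto
  show ?case
  proof (cases "n = 1")
    case False
    then obtain q where q: "prime q" "q dvd n"
      using prime_factor_nat by blast
    then obtain t where t: "n = q * t" by auto
    have nd: "\<not> q dvd t"
    proof
      assume "q dvd t"
      then have "q ^ 2 dvd n" by (simp add: t power2_eq_square)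
      with less.prems q(1) show False
        using squarefreeD[of n q] by (auto simp: prime_nat_iff)
    qed
    have "squarefree t" using less.prems t by (metis squarefree_multD(2))
    moreover have "t < n" using t n0 prime_gt_1_nat[OF q(1)] by simp
    ultimately show ?thesis using less.IH[of t] assms(3)[OF q(1) nd] t by simp
  qed (use assms(2) in simp)
qed

text \<open>Primes are handed out in pairs: \<open>q\<close> holds an unpaired prime back until the
  next one arrives, then the two go to different factors and double both divisor counts, so that the
  counts stay equal.\<close>

lemma squarefree_balanced_split:
  assumes "squarefree (t :: nat)"
  shows "\<exists>a b q. t = a * b * q \<and> (q = 1 \<or> prime q) \<and> divisor_count a = divisor_count b"
  using assms
proof (induction t rule: squarefree_nat_induct)
  case one
  show ?case by (intro exI[of _ 1]) simp
next
  case (prime q t)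
  then obtain a b r where abr: "t = a * b * r" "r = 1 \<or> Factorial_Ring.prime r"
    "divisor_count a = divisor_count b" by blast
  have t0: "t > 0" using prime(3) by (cases t) auto
  show ?case
  proof (cases "r = 1")
    case True
    then show ?thesis using abr prime(1) by (intro exI[of _ a] exI[of _ b] exI[of _ q]) simp
  next
    case False
    then have r: "Factorial_Ring.prime r" using abr by simp
    have "\<not> r dvd a"
    proof
      assume "r dvd a"
      then have "r ^ 2 dvd t" by (auto simp: abr(1) power2_eq_square intro: mult_dvd_mono)
      with prime(3) r show False using squarefreeD[of t r] by (auto simp: prime_nat_iff)
    qed
    moreover have "\<not> q dvd b" using prime(2) abr(1) by auto
    ultimately have "divisor_count (r * a) = divisor_count (q * b)"
      using t0 abr r prime(1) by (subst (1 2) divisor_count_prime_mult) auto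
    then show ?thesis using abr(1)
      by (intro exI[of _ "r * a"] exI[of _ "q * b"] exI[of _ 1]) simp
  qed
qed

lemma divisor_count_le_2: "q = 1 \<or> prime q \<Longrightarrow> divisor_count q \<le> 2"
  using divisor_count_prime_mult[of q 1] by (auto simp: divisor_count_def prime_nat_iff)

text \<open>The smaller of the two balanced factors is at most the square root of \<open>t\<close>,
  and both have the same divisor count; the leftover prime costs the factor 2.\<close>

lemma squarefree_sqrt_divisor:
  assumes "squarefree (t :: nat)"
  shows "\<exists>w. w dvd t \<and> w ^ 2 \<le> t \<and> divisor_count t \<le> 2 * divisor_count w ^ 2"
proof -
  obtain a b q where abq: "t = a * b * q" "q = 1 \<or> prime q" "divisor_count a = divisor_count b"
    using squarefree_balanced_split[OF assms] by blast
  have "t > 0" using assms by (cases t) auto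
  then have pos: "a > 0" "b > 0" "q > 0" using abq by auto
  have "divisor_count t \<le> divisor_count (a * b) * divisor_count q"
    unfolding abq(1) using pos by (intro divisor_count_mult_le) auto
  also have "\<dots> \<le> (divisor_count a * divisor_count b) * 2"
    using pos by (intro mult_mono divisor_count_mult_le divisor_count_le_2 abq) auto
  finally have le: "divisor_count t \<le> 2 * divisor_count a ^ 2"
    by (simp add: abq(3) power2_eq_square mult.commute)
  have "min a b ^ 2 \<le> a * b" by (auto simp: min_def power2_eq_square)
  also have "\<dots> \<le> t" using pos by (simp add: abq(1))
  finally have "min a b ^ 2 \<le> t" .
  moreover have "min a b dvd t" by (auto simp: min_def abq(1))
  moreover have "divisor_count (min a b) = divisor_count a" by (simp add: min_def abq(3))
  ultimately show ?thesis using le by (intro exI[of _ "min a b"]) simp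
qed

text \<open>Iterates \<open>squarefree_sqrt_divisor\<close>. The factors 2 on both sides make one
  round an exact squaring: \<tau>(t) \<le> 2 \<tau>(w)^2 becomes 2 \<tau>(t) \<le> (2
  \<tau>(w))^2.\<close>

lemma squarefree_small_divisor:
  assumes "squarefree (t :: nat)"
  shows "\<exists>w. w dvd t \<and> w ^ (2 ^ i) \<le> t \<and> 2 * divisor_count t \<le> (2 * divisor_count w) ^ (2 ^ i)"
  using assms
proof (induction i arbitrary: t)
  case 0
  show ?case by (intro exI[of _ t]) simp
next
  case (Suc i)
  obtain w where w: "w dvd t" "w ^ 2 \<le> t" "divisor_count t \<le> 2 * divisor_count w ^ 2"
    using squarefree_sqrt_divisor[OF Suc.prems] by blast
  have "squarefree w" using squarefree_mono[OF w(1) Suc.prems] .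
  then obtain z where z: "z dvd w" "z ^ (2 ^ i) \<le> w"
    "2 * divisor_count w \<le> (2 * divisor_count z) ^ (2 ^ i)" using Suc.IH by blast
  have "z ^ (2 ^ Suc i) = (z ^ (2 ^ i)) ^ 2" by (simp add: power_mult[symmetric] mult.commute)
  also have "\<dots> \<le> w ^ 2" by (intro power_mono z) auto
  finally have "z ^ (2 ^ Suc i) \<le> t" using w(2) by simp
  moreover have "2 * divisor_count t \<le> (2 * divisor_count w) ^ 2"
    using w(3) by (simp add: power_mult_distrib)
  moreover have "(2 * divisor_count w) ^ 2 \<le> ((2 * divisor_count z) ^ (2 ^ i)) ^ 2"
    by (intro power_mono z) auto
  moreover have "((2 * divisor_count z) ^ (2 ^ i)) ^ 2 = (2 * divisor_count z) ^ (2 ^ Suc i)"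
    by (simp only: power_mult[symmetric] power_Suc mult.commute)
  ultimately show ?case using z(1) w(1) by (intro exI[of _ z]) (metis dvd_trans order_trans)
qed

text \<open>Write \<open>v = m * u ^ 2\<close> with \<open>m\<close> squarefree, so that \<tau>(v)
  \<le> \<tau>(m) \<tau>(u)^2. Whichever of \<open>m\<close> and \<open>u\<close> has more divisors
  bounds \<tau>(v) by a cube: \<open>m\<close> ends the search, whereas \<open>u\<close> is
  decomposed again. Each round multiplies the exponent of the divisor count by 3 and doubles the
  power that divides \<open>v\<close>.\<close>

lemma divisor_count_square_or_squarefree:
  assumes "v > 0"
  shows "(\<exists>u>0. u ^ (2 ^ i) dvd v \<and> divisor_count v \<le> divisor_count u ^ (3 ^ i)) \<or>
    (\<exists>t. squarefree t \<and> t dvd v \<and> divisor_count v \<le> divisor_count t ^ (3 ^ i))"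
  using assms
proof (induction i arbitrary: v)
  case 0
  then show ?case by auto
next
  case (Suc i)
  define m u where "m = squarefree_part v" and "u = square_part v"
  have v: "v = m * u ^ 2" unfolding m_def u_def by (rule squarefree_decompose)
  have pos: "m > 0" "u > 0" using v Suc.prems by auto
  have "divisor_count v \<le> divisor_count m * divisor_count (u * u)"
    unfolding v power2_eq_square using pos by (intro divisor_count_mult_le) auto
  also have "\<dots> \<le> divisor_count m * (divisor_count u * divisor_count u)"
    using pos by (intro mult_mono divisor_count_mult_le) auto
  finally have le: "divisor_count v \<le> divisor_count m * (divisor_count u * divisor_count u)" .
  show ?case
  proof (cases "divisor_count u \<le> divisor_count m")
    case True
    have "divisor_count v \<le> divisor_count m ^ 3"
      using order_trans[OF le mult_mono[OF order_refl mult_mono[OF True True]]]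
      by (simp add: numeral_eq_Suc)
    also have "\<dots> \<le> divisor_count m ^ (3 ^ Suc i)"
      using divisor_count_pos[OF pos(1)] by (intro power_increasing) auto
    finally show ?thesis using v unfolding m_def by (metis dvd_triv_left squarefree_squarefree_part)
  next
    case False
    have "divisor_count v \<le> divisor_count u ^ 3"
      using order_trans[OF le mult_mono[of "divisor_count m" "divisor_count u"]] False
      by (simp add: numeral_eq_Suc)
    then have *: "divisor_count v \<le> X ^ (3 ^ Suc i)" if "divisor_count u \<le> X ^ (3 ^ i)" for X
      using power_mono[OF that, of 3] by (simp add: power_mult[symmetric] mult.commute)
    from Suc.IH[OF pos(2)] show ?thesis
    proof (elim disjE exE conjE)
      fix z assume z: "z > 0" "z ^ (2 ^ i) dvd u" "divisor_count u \<le> divisor_count z ^ (3 ^ i)"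
      have "(z ^ (2 ^ i)) ^ 2 dvd u ^ 2" using z(2) by (rule dvd_power_same)
      then have "z ^ (2 ^ Suc i) dvd v"
        unfolding v by (simp add: power_mult[symmetric] mult.commute)
      then show ?thesis using * z by blast
    next
      fix t assume t: "squarefree t" "t dvd u" "divisor_count u \<le> divisor_count t ^ (3 ^ i)"
      then have "t dvd v" unfolding v by (simp add: power2_eq_square)
      then show ?thesis using * t by blast
    qed
  qed
qed

section \<open>Logarithmic moments of the divisor count\<close>

lemma sum_inverse_le_ln:
  assumes "M \<ge> 1"
  shows "(\<Sum>u=1..M. 1 / real u) \<le> 1 + ln (real M)"
  using assms
proof (induction M rule: nat_induct_at_least)
  case (Suc n)
  have "1 / real (Suc n) \<le> ln (real (Suc n)) - ln (real n)"
    using Suc.hyps ln_diff_le[of "real n" "real (Suc n)"] by (simp add: field_simps)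
  then show ?case using Suc by simp
qed simp

text \<open>Since \<open>\<tau>(u)\<close> counts the factorisations \<open>u = d e\<close>, the sum for \<open>j + 1\<close> is at most the
  square of the sum for \<open>j\<close>.\<close>

lemma sum_divisor_count_power_le:
  assumes "M \<ge> 1"
  shows "(\<Sum>u=1..M. real (divisor_count u) ^ j / real u) \<le> (1 + ln (real M)) ^ (2 ^ j)"
proof (induction j)
  case 0
  show ?case using sum_inverse_le_ln[OF assms] by simp
next
  case (Suc j)
  let ?f = "\<lambda>u. real (divisor_count u) ^ j / real u"
  have fin: "finite {d. d dvd u}" if "u \<in> {1..M}" for u using that by auto
  have "(\<Sum>u=1..M. real (divisor_count u) ^ Suc j / real u) = (\<Sum>u=1..M. \<Sum>d | d dvd u. ?f u)"
    by (simp add: divisor_count_def)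
  also have "\<dots> = (\<Sum>(u, d)\<in>(SIGMA u:{1..M}. {d. d dvd u}). ?f u)"
    by (subst sum.Sigma) (use fin in auto)
  also have "\<dots> = (\<Sum>(d, e)\<in>(\<lambda>(u, d). (d, u div d)) ` (SIGMA u:{1..M}. {d. d dvd u}). ?f (d * e))"
    by (subst sum.reindex) (auto simp: inj_on_def intro!: sum.cong elim!: dvdE)
  \<comment> \<open>The image consists of pairs with \<open>d * e\<close> at most \<open>M\<close>;
    enlarging it to the full box is what lets the sum factor.\<close>
  also have "\<dots> \<le> (\<Sum>(d, e)\<in>{1..M} \<times> {1..M}. ?f (d * e))"
  proof (intro sum_mono2)
    show "(\<lambda>(u, d). (d, u div d)) ` (SIGMA u:{1..M}. {d. d dvd u}) \<subseteq> {1..M} \<times> {1..M}"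
    proof clarsimp
      fix u d assume "Suc 0 \<le> u" "u \<le> M" "d dvd u"
      then show "Suc 0 \<le> d \<and> d \<le> M \<and> Suc 0 \<le> u div d \<and> u div d \<le> M"
        using dvd_imp_le[of d u]
        by (auto simp: Suc_le_eq div_greater_zero_iff
            intro: dvd_pos_nat order_trans[OF div_le_dividend])
    qed
  qed auto
  also have "\<dots> \<le> (\<Sum>(d, e)\<in>{1..M} \<times> {1..M}. ?f d * ?f e)"
  proof (intro sum_mono, clarify)
    fix d e assume de: "d \<in> {1..M}" "e \<in> {1..M}"
    have "real (divisor_count (d * e)) ^ j \<le> (real (divisor_count d) * real (divisor_count e)) ^ j"
      using divisor_count_mult_le[of d e] de
      by (intro power_mono) (auto simp flip: of_nat_mult)
    then show "?f (d * e) \<le> ?f d * ?f e"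
      by (simp add: power_mult_distrib divide_right_mono)
  qed
  also have "\<dots> = (\<Sum>u=1..M. ?f u) ^ 2"
    by (simp add: sum.cartesian_product[symmetric] sum_product power2_eq_square)
  also have "\<dots> \<le> ((1 + ln (real M)) ^ (2 ^ j)) ^ 2"
    by (intro power_mono Suc.IH sum_nonneg) auto
  finally show ?case by (simp add: power_mult[symmetric] mult.commute)
qed

section \<open>Roots of integer polynomials to a modulus\<close>

text \<open>The Vandermonde determinant of the nodes, built one node at a time so that a recursion
  step matches one synthetic division in \<open>dvd_coeff_vandermonde\<close>.\<close>

fun vandermonde :: "int list \<Rightarrow> int" where
  "vandermonde [] = 1"
| "vandermonde (w # ws) = (\<Prod>x\<leftarrow>ws. x - w) * vandermonde ws"

lemma dvd_prod_list_of_mem: "x \<in> set xs \<Longrightarrow> (f x :: int) dvd (\<Prod>x\<leftarrow>xs. f x)"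
  by (induction xs) auto

text \<open>Interpolation without division: synthetic division by \<open>X - w\<close> leaves a
  quotient \<open>g\<close> with \<open>B dvd (x - w) * poly g x\<close> at the other nodes, and
  multiplying by the product \<open>D\<close> of all \<open>x - w\<close> makes
  \<open>smult D g\<close> divisible by \<open>B\<close> there. The induction strips off one node
  and one degree at a time.\<close>

lemma dvd_coeff_vandermonde:
  fixes f :: "int poly"
  assumes "degree f \<le> length ws" "\<And>x. x \<in> set (w # ws) \<Longrightarrow> B dvd poly f x"
  shows "B dvd coeff f (length ws) * vandermonde (w # ws)"
  using assms
proof (induction ws arbitrary: f w)
  case Nil
  then obtain c where "f = [:c:]" using degree_eq_zeroE by auto
  then show ?case using Nil(2)[of w] by simp
next
  case (Cons z ws)
  define g where "g = synthetic_div f w"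
  define D where "D = (\<Prod>x\<leftarrow>z # ws. x - w)"
  have f: "f = [:-w, 1:] * g + [:poly f w:]"
    unfolding g_def using synthetic_div_correct'[of w f] by simp
  have degg: "degree g \<le> length ws"
    unfolding g_def degree_synthetic_div using Cons.prems(1) by simp
  have "B dvd coeff (smult D g) (length ws) * vandermonde (z # ws)"
  proof (rule Cons.IH)
    show "degree (smult D g) \<le> length ws"
      using degg degree_smult_le order_trans by blast
  next
    fix x assume x: "x \<in> set (z # ws)"
    have "poly f x = (x - w) * poly g x + poly f w"
      by (subst f) (simp add: algebra_simps)
    then have "B dvd (x - w) * poly g x"
      using Cons.prems(2)[of x] Cons.prems(2)[of w] x
      by (metis add_diff_cancel_right' dvd_diff list.set_intros(1) list.set_intros(2))
    moreover have "(x - w) dvd D" unfolding D_def by (rule dvd_prod_list_of_mem[OF x])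
    ultimately show "B dvd poly (smult D g) x"
      by (metis dvd_trans mult_dvd_mono dvd_refl poly_smult)
  qed
  moreover have "coeff f (length (z # ws)) = coeff g (length ws)"
  proof -
    have "coeff g (Suc (length ws)) = 0" using degg by (intro coeff_eq_0) simp
    then show ?thesis by (subst f) simp
  qed
  ultimately show ?case by (simp add: D_def mult_ac)
qed

lemma vandermonde_nonzero: "distinct ws \<Longrightarrow> vandermonde ws \<noteq> 0"
  by (induction ws) (auto simp: prod_list_zero_iff)

lemma abs_prod_list_le:
  fixes L :: int
  assumes "\<And>x. x \<in> set xs \<Longrightarrow> \<bar>f x\<bar> \<le> L" "L \<ge> 0"
  shows "\<bar>\<Prod>x\<leftarrow>xs. f x\<bar> \<le> L ^ length xs"
  using assms by (induction xs) (auto simp: abs_mult intro!: mult_mono)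

lemma abs_vandermonde_le:
  assumes "\<And>x y. x \<in> set ws \<Longrightarrow> y \<in> set ws \<Longrightarrow> \<bar>x - y\<bar> \<le> L" "L \<ge> 1"
  shows "\<bar>vandermonde ws\<bar> \<le> L ^ (length ws ^ 2)"
  using assms
proof (induction ws)
  case (Cons w ws)
  have "\<bar>vandermonde (w # ws)\<bar> \<le> L ^ length ws * L ^ (length ws ^ 2)"
    using Cons.prems
    by (auto simp: abs_mult intro!: mult_mono abs_prod_list_le Cons.IH)
  also have "\<dots> \<le> L ^ (length (w # ws) ^ 2)"
    unfolding power_add[symmetric] using Cons.prems
    by (intro power_increasing) (auto simp: power2_eq_square)
  finally show ?case .
qed simp

lemma finite_filter_interval_int: "finite {n \<in> {a..<b :: int}. P n}"
  by (rule finite_subset[OF Collect_restrict]) simp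

text \<open>One root more than the degree is what \<open>dvd_coeff_vandermonde\<close> consumes;
  subtracting \<open>c\<close> does not touch the leading coefficient because the degree is
  positive.\<close>

lemma many_roots_dvd_vandermonde:
  fixes p :: "int poly"
  assumes "degree p \<ge> 1" "finite W" "card W > degree p" "\<And>x. x \<in> W \<Longrightarrow> B dvd poly p x - c"
  obtains ws where "distinct ws" "set ws \<subseteq> W" "length ws = Suc (degree p)"
    "B dvd lead_coeff p * vandermonde ws"
proof -
  obtain W' where W': "W' \<subseteq> W" "card W' = Suc (degree p)"
    by (rule obtain_subset_with_card_n[OF Suc_leI[OF assms(3)]])
  have "finite W'" using W'(1) assms(2) finite_subset by blast
  then obtain ws where ws: "set ws = W'" "distinct ws" using finite_distinct_list by blast
  have len: "length ws = Suc (degree p)" using distinct_card[OF ws(2)] ws(1) W'(2) by simp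
  then obtain w ws' where ww: "ws = w # ws'" by (cases ws) auto
  let ?f = "p - [:c:]"
  have "B dvd coeff ?f (length ws') * vandermonde (w # ws')"
  proof (rule dvd_coeff_vandermonde)
    show "degree ?f \<le> length ws'"
      using len ww by (intro order_trans[OF degree_diff_le_max]) simp
  next
    fix x assume "x \<in> set (w # ws')"
    then show "B dvd poly ?f x" using assms(4)[of x] ws W' ww by auto
  qed
  moreover have "coeff ?f (length ws') = lead_coeff p"
    using len ww assms(1) by (cases "degree p") auto
  ultimately have "B dvd lead_coeff p * vandermonde ws" by (simp add: ww)
  then show ?thesis using that[of ws] ws W' len by blast
qed

section \<open>Numbers of roots modulo powers, primes and squarefree integers\<close>

text \<open>Nodes in an interval of length \<open>u\<close> have a Vandermonde product of size at
  most \<open>u ^ (Suc (degree p) ^ 2)\<close>, too small for a nonzero multiple of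
  \<open>u ^ h\<close>. Hence the count does not grow with \<open>u\<close>. If \<open>u\<close> is
  at most the leading coefficient in absolute value, the length of the interval is bound
  enough.\<close>

lemma card_roots_power_le:
  fixes p :: "int poly"
  assumes "degree p \<ge> 1" "u > 0" "h > Suc (degree p) ^ 2"
  shows "card {n \<in> {a..<a + int u}. int u ^ h dvd poly p n - c} \<le> max (degree p) (nat \<bar>lead_coeff p\<bar>)"
    (is "card ?W \<le> _")
proof (cases "u \<le> nat \<bar>lead_coeff p\<bar>")
  case True
  have "card ?W \<le> card {a..<a + int u}" by (intro card_mono) auto
  then show ?thesis using True by simp
next
  case False
  have "card ?W \<le> degree p"
  proof (rule ccontr)
    assume "\<not> card ?W \<le> degree p"
    then have gt: "card ?W > degree p" and fin: "finite ?W"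
      by (simp_all only: not_le finite_filter_interval_int)
    obtain ws where ws: "distinct ws" "set ws \<subseteq> ?W" "length ws = Suc (degree p)"
      "int u ^ h dvd lead_coeff p * vandermonde ws"
      by (rule many_roots_dvd_vandermonde[OF assms(1) fin gt, of "int u ^ h" c]; blast)
    have nz: "lead_coeff p * vandermonde ws \<noteq> 0"
      using vandermonde_nonzero[OF ws(1)] assms(1) by auto
    have "\<bar>vandermonde ws\<bar> \<le> int u ^ (length ws ^ 2)"
    proof (rule abs_vandermonde_le)
      fix x y assume "x \<in> set ws" "y \<in> set ws"
      then have "x \<in> {a..<a + int u}" "y \<in> {a..<a + int u}" using ws(2) by auto
      then show "\<bar>x - y\<bar> \<le> int u" by auto
    qed (use assms(2) in simp)
    then have "\<bar>lead_coeff p * vandermonde ws\<bar> \<le> \<bar>lead_coeff p\<bar> * int u ^ (Suc (degree p) ^ 2)"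
      by (simp add: abs_mult mult_left_mono ws(3))
    also have "\<dots> < int u * int u ^ (Suc (degree p) ^ 2)"
      using False assms(2) by (intro mult_strict_right_mono) auto
    also have "\<dots> = int u ^ Suc (Suc (degree p) ^ 2)" by simp
    also have "\<dots> \<le> int u ^ h" using assms by (intro power_increasing) auto
    also have "\<dots> \<le> \<bar>lead_coeff p * vandermonde ws\<bar>"
      using dvd_imp_le_int[OF nz ws(4)] by simp
    finally show False by simp
  qed
  then show ?thesis by simp
qed

text \<open>Lagrange's bound by the same Vandermonde argument, since differences of distinct
  residues are units modulo a prime. If \<open>q\<close> divides the leading coefficient, then
  \<open>q\<close> is itself bounded by it.\<close>

lemma card_roots_prime_le:
  fixes p :: "int poly"
  assumes "degree p \<ge> 1" "prime q"
  shows "card {n \<in> {0..<int q}. int q dvd poly p n - c} \<le> max (degree p) (nat \<bar>lead_coeff p\<bar>)"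
    (is "card ?W \<le> _")
proof (cases "int q dvd lead_coeff p")
  case True
  have "lead_coeff p \<noteq> 0" using assms(1) by auto
  then have "int q \<le> \<bar>lead_coeff p\<bar>" using dvd_imp_le_int[OF _ True] by simp
  moreover have "card ?W \<le> card {0..<int q}" by (intro card_mono) auto
  ultimately show ?thesis by simp
next
  case False
  have q: "prime (int q)" using assms(2) by simp
  have nd: "\<not> int q dvd vandermonde ws" if "distinct ws" "set ws \<subseteq> {0..<int q}" for ws
    using that
  proof (induction ws)
    case Nil
    then show ?case using q by auto
  next
    case (Cons w ws)
    have "\<not> int q dvd (\<Prod>x\<leftarrow>xs. x - w)" if "set xs \<subseteq> {0..<int q}" "w \<notin> set xs" for xs
      using that
    proof (induction xs)
      case Nil
      then show ?case using q by auto
    next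
      case (Cons x xs)
      have "\<not> int q dvd x - w"
      proof
        assume "int q dvd x - w"
        then have "int q \<le> \<bar>x - w\<bar>" using Cons.prems dvd_imp_le_int[of "x - w" "int q"] by auto
        then show False using Cons.prems \<open>set (w # ws) \<subseteq> _\<close> by auto
      qed
      then show ?case using Cons q by (auto simp: prime_dvd_mult_iff)
    qed
    from this[of ws] show ?case using Cons q by (auto simp: prime_dvd_mult_iff)
  qed
  have "card ?W \<le> degree p"
  proof (rule ccontr)
    assume "\<not> card ?W \<le> degree p"
    then have gt: "card ?W > degree p" and fin: "finite ?W"
      by (simp_all only: not_le finite_filter_interval_int)
    obtain ws where ws: "distinct ws" "set ws \<subseteq> ?W" "int q dvd lead_coeff p * vandermonde ws"
      by (rule many_roots_dvd_vandermonde[OF assms(1) fin gt, of "int q" c]; blast)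
    from ws(2) have "set ws \<subseteq> {0..<int q}" by blast
    from nd[OF ws(1) this] show False using ws(3) False q by (simp add: prime_dvd_mult_iff)
  qed
  then show ?thesis by simp
qed

lemma dvd_poly_diff: "(a - b :: int) dvd poly p a - poly p b"
proof (induction p)
  case (pCons c p)
  have "poly (pCons c p) a - poly (pCons c p) b = (a - b) * poly p a + b * (poly p a - poly p b)"
    by (simp add: algebra_simps)
  then show ?case using pCons by simp
qed simp

lemma dvd_poly_mod_iff: "t dvd poly p (n mod t) - c \<longleftrightarrow> (t :: int) dvd poly p n - c"
proof -
  have "t dvd n mod t - n" by (metis dvd_minus_mod minus_diff_eq dvd_minus_iff)
  then have "t dvd poly p (n mod t) - poly p n" using dvd_poly_diff dvd_trans by blast
  then have "t dvd (poly p (n mod t) - poly p n) + (poly p n - c) \<longleftrightarrow> t dvd poly p n - c"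
    by (rule dvd_add_right_iff)
  then show ?thesis by simp
qed

text \<open>By the Chinese remainder theorem, roots modulo \<open>q * t\<close> inject into pairs of
  roots. Each prime contributes at most \<open>2 ^ k\<close>, and over the primes of
  \<open>t\<close> these factors multiply to the \<open>k\<close>-th power of the divisor
  count.\<close>

lemma card_roots_squarefree_residues_le:
  fixes p :: "int poly"
  assumes "degree p \<ge> 1" "squarefree t" "max (degree p) (nat \<bar>lead_coeff p\<bar>) \<le> 2 ^ k"
  shows "card {n \<in> {0..<int t}. int t dvd poly p n - c} \<le> divisor_count t ^ k"
  using assms(2)
proof (induction t rule: squarefree_nat_induct)
  case one
  have "card {n \<in> {0..<int 1}. int 1 dvd poly p n - c} \<le> card {0 :: int}"
    by (intro card_mono) auto
  then show ?case by (simp add: divisor_count_def)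
next
  case (prime q t)
  have t0: "t > 0" using prime by (cases t) auto
  have q0: "q > 0" using prime by (simp add: prime_gt_0_nat)
  let ?R = "\<lambda>t. {n \<in> {0..<int t}. int t dvd poly p n - c}"
  have cop: "coprime (int q) (int t)"
    using prime by (simp add: prime_imp_coprime)
  have "card (?R (q * t)) \<le> card (?R q \<times> ?R t)"
  proof (rule card_inj_on_le)
    show "inj_on (\<lambda>n. (n mod int q, n mod int t)) (?R (q * t))"
    proof (rule inj_onI)
      fix x y assume xy: "x \<in> ?R (q * t)" "y \<in> ?R (q * t)"
        "(x mod int q, x mod int t) = (y mod int q, y mod int t)"
      then have "int q dvd x - y" "int t dvd x - y" by (auto simp: mod_eq_dvd_iff)
      then have "int q * int t dvd x - y" using cop by (rule divides_mult)
      then have "x mod (int q * int t) = y mod (int q * int t)" by (simp add: mod_eq_dvd_iff)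
      then show "x = y" using xy by simp
    qed
    show "(\<lambda>n. (n mod int q, n mod int t)) ` ?R (q * t) \<subseteq> ?R q \<times> ?R t"
      using t0 q0 by (auto simp: dvd_poly_mod_iff intro: dvd_mult_left dvd_mult_right)
    show "finite (?R q \<times> ?R t)" by (intro finite_cartesian_product finite_filter_interval_int)
  qed
  also have "\<dots> \<le> 2 ^ k * divisor_count t ^ k"
    unfolding card_cartesian_product
    by (intro mult_mono prime.IH order_trans[OF card_roots_prime_le[OF assms(1) prime(1)] assms(3)]) auto
  also have "\<dots> = divisor_count (q * t) ^ k"
    using prime t0 by (subst divisor_count_prime_mult) (auto simp: power_mult_distrib)
  finally show ?case .
qed

text \<open>Reduction modulo \<open>t\<close> is injective on every interval of length
  \<open>t\<close>.\<close>

lemma card_roots_squarefree_le: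
  fixes p :: "int poly"
  assumes "degree p \<ge> 1" "squarefree t" "max (degree p) (nat \<bar>lead_coeff p\<bar>) \<le> 2 ^ k"
  shows "card {n \<in> {a..<a + int t}. int t dvd poly p n - c} \<le> divisor_count t ^ k"
proof -
  have t0: "t > 0" using assms(2) by (cases t) auto
  have "card {n \<in> {a..<a + int t}. int t dvd poly p n - c}
      \<le> card {n \<in> {0..<int t}. int t dvd poly p n - c}"
  proof (rule card_inj_on_le)
    show "inj_on (\<lambda>n. n mod int t) {n \<in> {a..<a + int t}. int t dvd poly p n - c}"
    proof (rule inj_onI)
      fix x y assume xy: "x \<in> {n \<in> {a..<a + int t}. int t dvd poly p n - c}"
        "y \<in> {n \<in> {a..<a + int t}. int t dvd poly p n - c}" "x mod int t = y mod int t"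
      then have "int t dvd x - y" by (simp add: mod_eq_dvd_iff)
      then have "x = y \<or> int t \<le> \<bar>x - y\<bar>" using dvd_imp_le_int[of "x - y" "int t"] by auto
      moreover have "\<bar>x - y\<bar> < int t" using xy by auto
      ultimately show "x = y" by linarith
    qed
    show "(\<lambda>n. n mod int t) ` {n \<in> {a..<a + int t}. int t dvd poly p n - c}
        \<subseteq> {n \<in> {0..<int t}. int t dvd poly p n - c}"
      using t0 by (auto simp: dvd_poly_mod_iff)
  qed (rule finite_filter_interval_int)
  then show ?thesis using card_roots_squarefree_residues_le[OF assms, of c] by simp
qed

text \<open>The range below \<open>M\<close> is covered by \<open>M div u + 1\<close> blocks of
  length \<open>u\<close>; since \<open>u \<le> M\<close>, their number is at most
  \<open>2 * M / u\<close>.\<close>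

lemma card_le_of_interval_bound:
  assumes "\<And>a. card {n \<in> {a..<a + int u}. Q n} \<le> K" "1 \<le> u" "u \<le> M"
  shows "real (card {n. n < M \<and> Q (int n)}) \<le> 2 * real M * real K / real u"
proof -
  let ?I = "\<lambda>i. {n \<in> {int (i * u)..<int (i * u) + int u}. Q n}"
  have "card {n. n < M \<and> Q (int n)} \<le> card (\<Union>i\<in>{..M div u}. ?I i)"
  proof (rule card_inj_on_le)
    show "inj_on int {n. n < M \<and> Q (int n)}" by simp
    show "int ` {n. n < M \<and> Q (int n)} \<subseteq> (\<Union>i\<in>{..M div u}. ?I i)"
    proof clarify
      fix n assume n: "n < M" "Q (int n)"
      have "n div u * u \<le> n" "n < n div u * u + u"
        using assms(2) dividend_less_div_times[of u n] by auto
      then have "int (n div u * u) \<le> int n" "int n < int (n div u * u) + int u"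
        by linarith+
      moreover have "n div u \<le> M div u" using n by (intro div_le_mono) simp
      ultimately show "int n \<in> (\<Union>i\<in>{..M div u}. ?I i)" using n(2)
        by (intro UN_I[of "n div u"]) simp_all
    qed
    show "finite (\<Union>i\<in>{..M div u}. ?I i)" by (intro finite_UN_I finite_subset[OF Collect_restrict]) auto
  qed
  also have "\<dots> \<le> (\<Sum>i\<in>{..M div u}. card (?I i))" by (rule card_UN_le) simp
  also have "\<dots> \<le> (\<Sum>i\<in>{..M div u}. K)" by (intro sum_mono assms(1))
  finally have "card {n. n < M \<and> Q (int n)} \<le> (M div u + 1) * K" by simp
  then have "real (card {n. n < M \<and> Q (int n)}) \<le> (real (M div u) + 1) * real K"
    by (metis of_nat_1 of_nat_add of_nat_le_iff of_nat_mult)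
  also have "\<dots> \<le> (2 * (real M / real u)) * real K"
  proof (intro mult_right_mono)
    have "real (M div u) \<le> real M / real u" by (rule of_nat_div_le_of_nat)
    moreover have "1 \<le> real M / real u" using assms by simp
    ultimately show "real (M div u) + 1 \<le> 2 * (real M / real u)" by linarith
  qed simp
  finally show ?thesis by simp
qed

section \<open>A gcd sum over polynomial differences\<close>

text \<open>One divisor controls \<tau>(v): a \<open>u\<close> whose power \<open>2 ^ i\<close>
  divides \<open>v\<close>, or a squarefree \<open>w\<close> with
  \<open>w ^ (2 ^ i) \<le> v\<close>. Both are at most \<open>M\<close>. Summing over all candidates
  instead of choosing one prepares the interchange with the sum over \<open>v\<close>. The exponent
  \<open>J\<close> is exact for \<open>w\<close> and generous for \<open>u\<close>.\<close>

lemma divisor_count_sq_le: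
  assumes "0 < v" "v \<le> M ^ (2 ^ i)"
  defines "J \<equiv> 2 * 3 ^ i * 2 ^ i"
  shows "real (divisor_count v) ^ 2 \<le>
    (\<Sum>u | u \<in> {1..M} \<and> u ^ (2 ^ i) dvd v. real (divisor_count u) ^ J) +
    (\<Sum>w | w \<in> {1..M} \<and> squarefree w \<and> w dvd v. (2 * real (divisor_count w)) ^ J)"
    (is "_ \<le> sum ?f ?U + sum ?g ?W")
proof -
  have nonneg: "0 \<le> sum ?f ?U" "0 \<le> sum ?g ?W" by (auto intro!: sum_nonneg)
  have M: "u \<le> M" if "u ^ (2 ^ i) \<le> v" for u
  proof (rule ccontr)
    assume "\<not> u \<le> M"
    then have "M ^ (2 ^ i) < u ^ (2 ^ i)" by (intro power_strict_mono) auto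
    then show False using that assms by simp
  qed
  have sq: "(x ^ (3 ^ i)) ^ 2 \<le> (x :: real) ^ J" if "x \<ge> 1" for x
  proof -
    have "(x ^ (3 ^ i)) ^ 2 = x ^ (2 * 3 ^ i)" by (simp add: power_mult[symmetric] mult.commute)
    also have "\<dots> \<le> x ^ J" unfolding J_def using that by (intro power_increasing) auto
    finally show ?thesis .
  qed
  from divisor_count_square_or_squarefree[OF assms(1), of i] show ?thesis
  proof (elim disjE exE conjE)
    fix u assume u: "u > 0" "u ^ (2 ^ i) dvd v" "divisor_count v \<le> divisor_count u ^ (3 ^ i)"
    have "real (divisor_count v) ^ 2 \<le> (real (divisor_count u) ^ (3 ^ i)) ^ 2"
      using u(3) by (intro power_mono) (auto simp flip: of_nat_power)
    also have "\<dots> \<le> ?f u" using divisor_count_pos[OF u(1)] by (intro sq) simp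
    also have "\<dots> \<le> sum ?f ?U"
      using u M[OF dvd_imp_le[OF u(2) assms(1)]] by (intro member_le_sum) auto
    finally show ?thesis using nonneg by linarith
  next
    fix t assume t: "squarefree t" "t dvd v" "divisor_count v \<le> divisor_count t ^ (3 ^ i)"
    obtain w where w: "w dvd t" "w ^ (2 ^ i) \<le> t"
      "2 * divisor_count t \<le> (2 * divisor_count w) ^ (2 ^ i)"
      using squarefree_small_divisor[OF t(1)] by blast
    have "t \<le> v" using t(2) assms(1) by (rule dvd_imp_le)
    then have "w \<le> M" using w(2) by (intro M) simp
    moreover have "w \<ge> 1" using w(1) t(1) by (cases w) auto
    moreover have "squarefree w" using squarefree_mono[OF w(1) t(1)] .
    moreover have "w dvd v" using w(1) t(2) by (rule dvd_trans)
    ultimately have wW: "w \<in> ?W" by simp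
    have "real (divisor_count t) \<le> (2 * real (divisor_count w)) ^ (2 ^ i)"
    proof -
      have "divisor_count t \<le> (2 * divisor_count w) ^ (2 ^ i)" using w(3) by simp
      then show ?thesis by (metis of_nat_le_iff of_nat_mult of_nat_numeral of_nat_power)
    qed
    moreover have "real (divisor_count v) \<le> real (divisor_count t) ^ (3 ^ i)"
      using t(3) by (simp flip: of_nat_power)
    ultimately have "real (divisor_count v) \<le> ((2 * real (divisor_count w)) ^ (2 ^ i)) ^ (3 ^ i)"
      by (meson of_nat_0_le_iff order_trans power_mono)
    then have "real (divisor_count v) ^ 2 \<le> (((2 * real (divisor_count w)) ^ (2 ^ i)) ^ (3 ^ i)) ^ 2"
      by (intro power_mono) auto
    also have "\<dots> = ?g w" unfolding J_def by (simp only: power_mult[symmetric] mult_ac)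
    also have "\<dots> \<le> sum ?g ?W" using wW by (intro member_le_sum) auto
    finally show ?thesis using nonneg by linarith
  qed
qed

text \<open>The bound \<open>M\<close> is exclusive, so \<open>Suc N\<close> covers the indices up
  to \<open>N\<close>. Pairs with equal values are kept apart in \<open>coincident_pairs\<close>,
  because the correlation estimates divide by the difference.\<close>

definition diff_pairs :: "int poly \<Rightarrow> nat \<Rightarrow> (nat \<times> nat) set" where
  "diff_pairs p M = {(m, n). 1 \<le> m \<and> m < n \<and> n < M \<and> poly p (int m) \<noteq> poly p (int n)}"

definition pair_diff :: "int poly \<Rightarrow> nat \<times> nat \<Rightarrow> int" where
  "pair_diff p = (\<lambda>(m, n). poly p (int n) - poly p (int m))"

lemma diff_pairs_subset: "diff_pairs p M \<subseteq> {..<M} \<times> {..<M}"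
  by (auto simp: diff_pairs_def)

lemma finite_diff_pairs: "finite (diff_pairs p M)"
  by (rule finite_subset[OF diff_pairs_subset]) simp

lemma pair_diff_nonzero: "\<pi> \<in> diff_pairs p M \<Longrightarrow> pair_diff p \<pi> \<noteq> 0"
  by (auto simp: diff_pairs_def pair_diff_def)

text \<open>For fixed \<open>m\<close> the divisibility is a congruence for \<open>n\<close> with
  target \<open>poly p (int m)\<close>; hence the uniformity in \<open>c\<close> of the
  hypothesis.\<close>

lemma card_diff_pairs_dvd_le:
  assumes "\<And>a c. card {n \<in> {a..<a + int u}. B dvd poly p n - c} \<le> K" "1 \<le> u" "u \<le> M"
  shows "real (card {\<pi> \<in> diff_pairs p M. B dvd pair_diff p \<pi>}) \<le> 2 * real M ^ 2 * real K / real u"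
proof -
  let ?N = "\<lambda>m. {n. n < M \<and> B dvd poly p (int n) - poly p (int m)}"
  have finN: "finite (?N m)" for m by (rule finite_subset[of _ "{..<M}"]) auto
  have "card {\<pi> \<in> diff_pairs p M. B dvd pair_diff p \<pi>} \<le> card (SIGMA m:{..<M}. ?N m)"
  proof (rule card_mono)
    show "finite (SIGMA m:{..<M}. ?N m)" by (intro finite_SigmaI finN finite_lessThan)
    show "{\<pi> \<in> diff_pairs p M. B dvd pair_diff p \<pi>} \<subseteq> (SIGMA m:{..<M}. ?N m)"
      by (auto simp: diff_pairs_def pair_diff_def)
  qed
  also have "\<dots> = (\<Sum>m<M. card (?N m))"
    by (rule card_SigmaI) (use finN in blast)+
  finally have "real (card {\<pi> \<in> diff_pairs p M. B dvd pair_diff p \<pi>}) \<le> (\<Sum>m<M. real (card (?N m)))"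
    by (simp only: of_nat_le_iff of_nat_sum[symmetric])
  also have "\<dots> \<le> (\<Sum>m<M. 2 * real M * real K / real u)"
    by (intro sum_mono card_le_of_interval_bound assms)
  finally show ?thesis by (simp add: power2_eq_square mult_ac)
qed

lemma abs_poly_le:
  fixes p :: "int poly"
  assumes "\<bar>x\<bar> \<le> y" "y \<ge> 1"
  shows "\<bar>poly p x\<bar> \<le> (\<Sum>j\<le>degree p. \<bar>coeff p j\<bar>) * y ^ degree p"
proof -
  have "\<bar>poly p x\<bar> \<le> (\<Sum>j\<le>degree p. \<bar>coeff p j * x ^ j\<bar>)"
    unfolding poly_altdef by (rule sum_abs)
  also have "\<dots> \<le> (\<Sum>j\<le>degree p. \<bar>coeff p j\<bar> * y ^ degree p)"
  proof (intro sum_mono)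
    fix j assume j: "j \<in> {..degree p}"
    have "\<bar>x\<bar> ^ j \<le> y ^ j" using assms by (intro power_mono) auto
    also have "\<dots> \<le> y ^ degree p" using assms j by (intro power_increasing) auto
    finally show "\<bar>coeff p j * x ^ j\<bar> \<le> \<bar>coeff p j\<bar> * y ^ degree p"
      by (simp add: abs_mult power_abs mult_left_mono)
  qed
  finally show ?thesis by (simp add: sum_distrib_right)
qed

text \<open>Polynomial growth as a pure power: since \<open>M\<close> is at least 2, the constant is
  absorbed through \<open>C < 2 ^ C \<le> M ^ C\<close>.\<close>

lemma pair_diff_le_power:
  "\<exists>h0. \<forall>M\<ge>2. \<forall>h\<ge>h0. \<forall>\<pi>\<in>diff_pairs p M. nat \<bar>pair_diff p \<pi>\<bar> \<le> M ^ h"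
proof -
  define C where "C = nat (2 * (\<Sum>j\<le>degree p. \<bar>coeff p j\<bar>))"
  have C: "int C = 2 * (\<Sum>j\<le>degree p. \<bar>coeff p j\<bar>)"
    unfolding C_def by (simp add: sum_nonneg)
  have "nat \<bar>pair_diff p \<pi>\<bar> \<le> M ^ h" if "M \<ge> 2" "h \<ge> C + degree p" "\<pi> \<in> diff_pairs p M" for M h \<pi>
  proof -
    obtain m n where \<pi>: "\<pi> = (m, n)" by (cases \<pi>)
    have mn: "m < M" "n < M" using that(3) by (auto simp: \<pi> diff_pairs_def)
    have b: "\<bar>poly p (int k)\<bar> \<le> (\<Sum>j\<le>degree p. \<bar>coeff p j\<bar>) * int M ^ degree p" if "k < M" for k
      using that by (intro abs_poly_le) auto
    have "\<bar>pair_diff p \<pi>\<bar> \<le> int C * int M ^ degree p"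
      using b[OF mn(1)] b[OF mn(2)] unfolding C by (simp add: \<pi> pair_diff_def)
    also have "\<dots> \<le> int M ^ C * int M ^ degree p"
    proof (intro mult_right_mono)
      have "C < 2 ^ C" by simp
      also have "\<dots> \<le> M ^ C" using that by (intro power_mono) auto
      finally show "int C \<le> int M ^ C" by (metis less_imp_le of_nat_le_iff of_nat_power)
    qed simp
    also have "\<dots> = int M ^ (C + degree p)" by (simp add: power_add)
    also have "\<dots> \<le> int M ^ h" using that by (intro power_increasing) auto
    finally have "\<bar>pair_diff p \<pi>\<bar> \<le> int (M ^ h)" by simp
    then show ?thesis by (simp only: nat_le_iff)
  qed
  then show ?thesis by blast
qed

lemma sum_card_swap:
  fixes f :: "'b \<Rightarrow> real"
  assumes "finite A" "finite B"
  shows "(\<Sum>a\<in>A. \<Sum>b | b \<in> B \<and> R a b. f b) = (\<Sum>b\<in>B. f b * real (card {a \<in> A. R a b}))"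
proof -
  have "(\<Sum>a\<in>A. \<Sum>b | b \<in> B \<and> R a b. f b) = (\<Sum>b\<in>B. \<Sum>a | a \<in> A \<and> R a b. f b)"
    using assms by (rule sum.swap_restrict)
  then show ?thesis by (simp add: mult.commute)
qed

text \<open>After interchanging the sums, \<open>u\<close> carries the number of pairs whose
  difference is divisible by \<open>u ^ h\<close>, which is O(M^2 / u), and \<open>w\<close> carries
  O(M^2 \<tau>(w)^K / w). Both totals are moments of the divisor count against the harmonic weight,
  hence powers of the logarithm.\<close>

lemma sum_divisor_count_sq_le:
  fixes p :: "int poly"
  assumes "degree p \<ge> 1"
  shows "\<exists>C E. C \<ge> 0 \<and> (\<forall>M\<ge>2. (\<Sum>\<pi>\<in>diff_pairs p M. real (divisor_count (nat \<bar>pair_diff p \<pi>\<bar>)) ^ 2)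
    \<le> C * real M ^ 2 * (1 + ln (real M)) ^ E)"
proof -
  obtain h0 where h0: "\<And>M h \<pi>. M \<ge> 2 \<Longrightarrow> h \<ge> h0 \<Longrightarrow> \<pi> \<in> diff_pairs p M \<Longrightarrow> nat \<bar>pair_diff p \<pi>\<bar> \<le> M ^ h"
    using pair_diff_le_power by blast
  \<comment> \<open>With \<open>h = 2 ^ i\<close> and \<open>i < 2 ^ i\<close>, this choice puts
    \<open>h\<close> above the growth exponent \<open>h0\<close> and above the threshold
    \<open>Suc (degree p) ^ 2\<close> of \<open>card_roots_power_le\<close>.\<close>
  define i where "i = h0 + Suc (degree p) ^ 2"
  define h :: nat where "h = 2 ^ i"
  have "i < h" unfolding h_def by simp
  then have h: "h \<ge> h0" "h > Suc (degree p) ^ 2" by (simp_all add: i_def)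
  define J :: nat where "J = 2 * 3 ^ i * 2 ^ i"
  define K where "K = max (degree p) (nat \<bar>lead_coeff p\<bar>)"
  have K: "K \<le> 2 ^ K" by (simp add: less_imp_le)
  define C :: real where "C = 2 * K + 2 ^ J * 2"
  \<comment> \<open>The largest moment that occurs is \<open>J + K\<close>: \<open>J\<close> from
    the pointwise bound and \<open>K\<close> from the roots modulo a squarefree
    \<open>w\<close>.\<close>
  define E :: nat where "E = 2 ^ (J + K)"
  have "(\<Sum>\<pi>\<in>diff_pairs p M. real (divisor_count (nat \<bar>pair_diff p \<pi>\<bar>)) ^ 2)
      \<le> C * real M ^ 2 * (1 + ln (real M)) ^ E" if M: "M \<ge> 2" for M
  proof -
    let ?P = "diff_pairs p M" and ?t = "\<lambda>u. real (divisor_count u)"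
    let ?v = "\<lambda>\<pi>. nat \<bar>pair_diff p \<pi>\<bar>"
    have dvd_iff: "k dvd ?v \<pi> \<longleftrightarrow> int k dvd pair_diff p \<pi>" for k \<pi>
      by (simp add: nat_abs_dvd_iff dvd_nat_abs_iff)
    have ln1: "1 + ln (real M) \<ge> 1" using M by simp
    have sum1: "(\<Sum>u=1..M. ?t u ^ j / real u) \<le> (1 + ln (real M)) ^ E" if "j \<le> J + K" for j
    proof -
      have "(\<Sum>u=1..M. ?t u ^ j / real u) \<le> (1 + ln (real M)) ^ (2 ^ j)"
        using M by (intro sum_divisor_count_power_le) auto
      also have "\<dots> \<le> (1 + ln (real M)) ^ E"
        unfolding E_def using ln1 that by (intro power_increasing) auto
      finally show ?thesis .
    qed
    have "(\<Sum>\<pi>\<in>?P. ?t (?v \<pi>) ^ 2) \<le>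
        (\<Sum>\<pi>\<in>?P. (\<Sum>u | u \<in> {1..M} \<and> u ^ h dvd ?v \<pi>. ?t u ^ J) +
          (\<Sum>w | w \<in> {1..M} \<and> squarefree w \<and> w dvd ?v \<pi>. (2 * ?t w) ^ J))"
    proof (intro sum_mono)
      fix \<pi> assume \<pi>: "\<pi> \<in> ?P"
      then have "?v \<pi> > 0" using pair_diff_nonzero by simp
      then show "?t (?v \<pi>) ^ 2 \<le> (\<Sum>u | u \<in> {1..M} \<and> u ^ h dvd ?v \<pi>. ?t u ^ J) +
          (\<Sum>w | w \<in> {1..M} \<and> squarefree w \<and> w dvd ?v \<pi>. (2 * ?t w) ^ J)"
        unfolding h_def J_def using h0[OF M h(1) \<pi>] by (intro divisor_count_sq_le) (auto simp: h_def)
    qed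
    also have "\<dots> = (\<Sum>u\<in>{1..M}. ?t u ^ J * real (card {\<pi> \<in> ?P. u ^ h dvd ?v \<pi>})) +
        (\<Sum>w\<in>{1..M}. (2 * ?t w) ^ J * real (card {\<pi> \<in> ?P. squarefree w \<and> w dvd ?v \<pi>}))"
      unfolding sum.distrib by (intro arg_cong2[of _ _ _ _ "(+)"] sum_card_swap finite_diff_pairs) simp_all
    also have "(\<Sum>u\<in>{1..M}. ?t u ^ J * real (card {\<pi> \<in> ?P. u ^ h dvd ?v \<pi>}))
        \<le> (\<Sum>u\<in>{1..M}. ?t u ^ J * (2 * real M ^ 2 * real K / real u))"
      unfolding dvd_iff of_nat_power K_def
      by (intro sum_mono mult_left_mono card_diff_pairs_dvd_le card_roots_power_le assms h) auto
    also have "\<dots> = 2 * K * real M ^ 2 * (\<Sum>u\<in>{1..M}. ?t u ^ J / real u)"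
      by (simp add: sum_distrib_left mult_ac)
    also have "\<dots> \<le> 2 * K * real M ^ 2 * (1 + ln (real M)) ^ E"
      by (intro mult_left_mono sum1) auto
    also have "(\<Sum>w\<in>{1..M}. (2 * ?t w) ^ J * real (card {\<pi> \<in> ?P. squarefree w \<and> w dvd ?v \<pi>}))
        \<le> (\<Sum>w\<in>{1..M}. (2 * ?t w) ^ J * (2 * real M ^ 2 * real (divisor_count w ^ K) / real w))"
    proof (intro sum_mono mult_left_mono)
      fix w assume w: "w \<in> {1..M}"
      show "real (card {\<pi> \<in> ?P. squarefree w \<and> w dvd ?v \<pi>})
          \<le> 2 * real M ^ 2 * real (divisor_count w ^ K) / real w"
      proof (cases "squarefree w")
        case True
        then have "real (card {\<pi> \<in> ?P. int w dvd pair_diff p \<pi>})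
            \<le> 2 * real M ^ 2 * real (divisor_count w ^ K) / real w"
          using w by (intro card_diff_pairs_dvd_le
              card_roots_squarefree_le[OF assms True K[unfolded K_def], folded K_def]) simp_all
        then show ?thesis using True by (simp add: dvd_iff)
      qed simp
    qed simp
    also have "\<dots> = 2 ^ J * 2 * real M ^ 2 * (\<Sum>w\<in>{1..M}. ?t w ^ (J + K) / real w)"
      by (simp add: sum_distrib_left mult_ac power_add power_mult_distrib)
    also have "\<dots> \<le> 2 ^ J * 2 * real M ^ 2 * (1 + ln (real M)) ^ E"
      by (intro mult_left_mono sum1) auto
    finally show ?thesis unfolding C_def by (simp add: algebra_simps)
  qed
  moreover have "C \<ge> 0" by (simp add: C_def)
  ultimately show ?thesis by blast
qed

section \<open>Multiplicity of a value among the differences\<close>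

text \<open>The solutions are the roots of a polynomial of degree at most \<open>degree p\<close>.
  If it vanished identically, \<open>p\<close> would be affine along the multiples of
  \<open>e\<close> and therefore affine everywhere, against \<open>degree p \<ge> 2\<close>.\<close>

lemma card_shift_difference_le:
  fixes p :: "int poly"
  assumes "degree p \<ge> 2" "e \<noteq> 0"
  shows "finite {x. poly p (x + e) - poly p x = c}"
    and "card {x. poly p (x + e) - poly p x = c} \<le> degree p"
proof -
  define q where "q = pcompose p [:e, 1:] - p - [:c:]"
  have poly_q: "poly q x = poly p (x + e) - poly p x - c" for x
    by (simp add: q_def poly_pcompose add.commute)
  have "q \<noteq> 0"
  proof
    assume "q = 0"
    then have step: "poly p (x + e) = poly p x + c" for x using poly_q[of x] by simp
    have lin: "poly p (int j * e) = poly p 0 + int j * c" for j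
    proof (induction j)
      case (Suc j)
      have "poly p (int (Suc j) * e) = poly p (int j * e + e)" by (simp add: algebra_simps)
      also have "\<dots> = poly p 0 + int j * c + c" by (simp only: step Suc)
      finally show ?case by (simp add: algebra_simps)
    qed simp
    \<comment> \<open>The comparison with the line through the values at multiples of
      \<open>e\<close>, scaled by \<open>e\<close> so that its slope stays an integer.\<close>
    define r where "r = smult e p - [:e * poly p 0, c:]"
    have "poly r (int j * e) = 0" for j unfolding r_def by (simp add: lin) (simp add: algebra_simps)
    then have "range (\<lambda>j. int j * e) \<subseteq> {x. poly r x = 0}" by auto
    moreover have "infinite (range (\<lambda>j. int j * e))"
      using assms(2) by (intro range_inj_infinite) (auto simp: inj_def)
    ultimately have "r = 0" using poly_roots_finite[of r] finite_subset by blast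
    then have "degree (smult e p) \<le> 1" by (simp add: r_def)
    then show False using assms by simp
  qed
  moreover have "degree q \<le> degree p"
    unfolding q_def by (intro degree_diff_le) (auto simp: degree_pcompose)
  moreover have "{x. poly p (x + e) - poly p x = c} = {x. poly q x = 0}"
    by (simp add: poly_q)
  ultimately show "finite {x. poly p (x + e) - poly p x = c}"
    and "card {x. poly p (x + e) - poly p x = c} \<le> degree p"
    using card_poly_roots_bound[of q] poly_roots_finite[of q] by auto
qed

text \<open>Since \<open>n - m\<close> divides \<open>poly p n - poly p m\<close>, the gap is one of
  the divisors of \<open>v\<close>. For each gap and each sign of the difference,
  \<open>card_shift_difference_le\<close> leaves at most \<open>degree p\<close> choices of
  \<open>m\<close>.\<close>

lemma card_pair_diff_fiber_le:
  fixes p :: "int poly"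
  assumes "degree p \<ge> 2" "v > 0"
  shows "card {\<pi> \<in> diff_pairs p M. nat \<bar>pair_diff p \<pi>\<bar> = v} \<le> 2 * degree p * divisor_count v"
proof -
  let ?F = "\<lambda>e c. {m. poly p (int m + int e) - poly p (int m) = c}"
  have F: "finite (?F e c)" "card (?F e c) \<le> degree p" if "e \<noteq> 0" for e c
  proof -
    have e: "int e \<noteq> 0" using that by simp
    have im: "int ` ?F e c \<subseteq> {x. poly p (x + int e) - poly p x = c}" by auto
    show "finite (?F e c)"
      using finite_subset[OF im card_shift_difference_le(1)[OF assms(1) e]]
      by (rule finite_imageD) simp
    have "card (?F e c) = card (int ` ?F e c)" by (simp add: card_image)
    also have "\<dots> \<le> degree p"
      using card_mono[OF card_shift_difference_le(1)[OF assms(1) e] im]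
        card_shift_difference_le(2)[OF assms(1) e] by (rule order_trans)
    finally show "card (?F e c) \<le> degree p" .
  qed
  let ?T = "\<lambda>(e, c). (\<lambda>m. (m, m + e)) ` ?F e c"
  let ?I = "{e. e dvd v} \<times> {int v, - int v}"
  have finI: "finite ?I" using assms(2) by simp
  have e0: "e \<noteq> 0" if "(e, c) \<in> ?I" for e c using that assms(2) by auto
  have "card {\<pi> \<in> diff_pairs p M. nat \<bar>pair_diff p \<pi>\<bar> = v} \<le> card (\<Union>i\<in>?I. ?T i)"
  proof (intro card_mono finite_UN_I[OF finI])
    show "finite (?T i)" if i: "i \<in> ?I" for i
    proof -
      obtain e c where ec: "i = (e, c)" by (cases i)
      show ?thesis unfolding ec prod.case using F(1)[OF e0] i ec by blast
    qed
    show "{\<pi> \<in> diff_pairs p M. nat \<bar>pair_diff p \<pi>\<bar> = v} \<subseteq> (\<Union>i\<in>?I. ?T i)"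
    proof clarify
      fix m n assume mn: "(m, n) \<in> diff_pairs p M" "v = nat \<bar>pair_diff p (m, n)\<bar>"
      have lt: "m < n" using mn(1) by (simp add: diff_pairs_def)
      have "int n - int m dvd pair_diff p (m, n)"
        unfolding pair_diff_def by (simp add: dvd_poly_diff)
      then have "n - m dvd nat \<bar>pair_diff p (m, n)\<bar>"
        using lt by (simp add: dvd_nat_abs_iff of_nat_diff)
      moreover have "pair_diff p (m, n) \<in> {int (nat \<bar>pair_diff p (m, n)\<bar>), - int (nat \<bar>pair_diff p (m, n)\<bar>)}"
        by auto
      moreover have "(m, n) \<in> ?T (n - m, pair_diff p (m, n))"
        using lt by (auto simp: pair_diff_def of_nat_diff)
      ultimately show "(m, n) \<in> (\<Union>i\<in>{e. e dvd nat \<bar>pair_diff p (m, n)\<bar>} \<times>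
          {int (nat \<bar>pair_diff p (m, n)\<bar>), - int (nat \<bar>pair_diff p (m, n)\<bar>)}. ?T i)"
        by (intro UN_I[of "(n - m, pair_diff p (m, n))"]) blast+
    qed
  qed
  also have "\<dots> \<le> (\<Sum>i\<in>?I. card (?T i))" by (rule card_UN_le[OF finI])
  also have "\<dots> \<le> (\<Sum>i\<in>?I. degree p)"
  proof (intro sum_mono)
    fix i assume i: "i \<in> ?I"
    obtain e c where ec: "i = (e, c)" by (cases i)
    show "card (?T i) \<le> degree p"
      unfolding ec prod.case using F[OF e0] i ec by (meson card_image_le order_trans)
  qed
  also have "\<dots> = card ?I * degree p" by simp
  also have "card ?I \<le> divisor_count v * 2"
    unfolding card_cartesian_product divisor_count_def
    by (intro mult_left_mono) (auto simp: card_insert_if)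
  finally show ?thesis by (simp add: mult_ac)
qed

section \<open>Schur's test for the gcd kernel\<close>

text \<open>With g = gcd(v, w) the summand is at most 1 / b for b = w / g. The pair (v / g, w / g)
  determines \<open>w\<close>, because its first entry determines g; that entry runs over divisors
  of \<open>v\<close>, and b contributes a harmonic sum.\<close>

lemma sum_gcd_max_le:
  assumes "1 \<le> v" "1 \<le> X"
  shows "(\<Sum>w=1..X. real (gcd v w) / real (max v w)) \<le> real (divisor_count v) * (1 + ln (real X))"
proof -
  let ?h = "\<lambda>w. (v div gcd v w, w div gcd v w)"
  have "(\<Sum>w=1..X. real (gcd v w) / real (max v w)) \<le> (\<Sum>w=1..X. case ?h w of (a, b) \<Rightarrow> 1 / real b)"
  proof (intro sum_mono)
    fix w assume w: "w \<in> {1..X}"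
    have "real (w div gcd v w) = real w / real (gcd v w)" by (simp add: real_of_nat_div)
    then have "1 / real (w div gcd v w) = real (gcd v w) / real w" by simp
    moreover have "real (gcd v w) / real (max v w) \<le> real (gcd v w) / real w"
      using w by (intro divide_left_mono) auto
    ultimately show "real (gcd v w) / real (max v w) \<le> (case ?h w of (a, b) \<Rightarrow> 1 / real b)" by simp
  qed
  also have "\<dots> = (\<Sum>(a, b)\<in>?h ` {1..X}. 1 / real b)"
  proof (subst sum.reindex)
    show "inj_on ?h {1..X}"
    proof (rule inj_onI)
      fix x y assume xy: "x \<in> {1..X}" "y \<in> {1..X}" "?h x = ?h y"
      have v: "v div gcd v z * gcd v z = v" "z div gcd v z * gcd v z = z" for z by auto
      have "v div gcd v x > 0" using assms by (simp add: div_greater_zero_iff)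
      then have "gcd v x = gcd v y" using v(1)[of x] v(1)[of y] xy(3)
        by (metis Pair_inject mult_cancel1 not_less_zero)
      then show "x = y" using v(2)[of x] v(2)[of y] xy(3) by (metis Pair_inject)
    qed
  qed simp
  also have "\<dots> \<le> (\<Sum>(a, b)\<in>{a. a dvd v} \<times> {1..X}. 1 / real b)"
  proof (intro sum_mono2)
    show "?h ` {1..X} \<subseteq> {a. a dvd v} \<times> {1..X}"
    proof (rule image_subsetI)
      fix w assume w: "w \<in> {1..X}"
      have "v div gcd v w dvd v" by (metis dvd_div_mult_self dvd_triv_left gcd_dvd1)
      moreover have "w div gcd v w \<le> X" using w by (auto intro: order_trans[OF div_le_dividend])
      moreover have "w div gcd v w \<ge> 1" using w by (auto simp: Suc_le_eq div_greater_zero_iff)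
      ultimately show "?h w \<in> {a. a dvd v} \<times> {1..X}" by simp
    qed
  qed (use assms in auto)
  also have "\<dots> = real (divisor_count v) * (\<Sum>b=1..X. 1 / real b)"
    by (simp add: sum.cartesian_product[symmetric] divisor_count_def)
  also have "\<dots> \<le> real (divisor_count v) * (1 + ln (real X))"
    using assms by (intro mult_left_mono sum_inverse_le_ln) auto
  finally show ?thesis .
qed

text \<open>Group by values with multiplicities \<open>r\<close>, apply r(v) r(w) \<le> (r(v)^2 +
  r(w)^2) / 2, and use the symmetry of the kernel to reduce to the row sums of
  \<open>sum_gcd_max_le\<close>. One factor \<open>r\<close> is finally turned back into a sum over
  \<open>A\<close>.\<close>

lemma gcd_sum_le:
  fixes f :: "'a \<Rightarrow> nat"
  assumes "finite A" "\<And>a. a \<in> A \<Longrightarrow> f a \<in> {1..X}" "1 \<le> X"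
  shows "(\<Sum>a\<in>A. \<Sum>b\<in>A. real (gcd (f a) (f b)) / real (max (f a) (f b)))
    \<le> (1 + ln (real X)) * (\<Sum>a\<in>A. real (card {b \<in> A. f b = f a}) * real (divisor_count (f a)))"
proof -
  define r where "r v = real (card {b \<in> A. f b = v})" for v
  define k where "k v w = real (gcd v w) / real (max v w)" for v w
  have k0: "k v w \<ge> 0" for v w by (simp add: k_def)
  have ksym: "k v w = k w v" for v w by (simp add: k_def gcd.commute max.commute)
  have grp: "(\<Sum>a\<in>A. g (f a)) = (\<Sum>v=1..X. r v * g v)" for g :: "nat \<Rightarrow> real"
  proof -
    have "(\<Sum>a\<in>A. g (f a)) = (\<Sum>v=1..X. \<Sum>a | a \<in> A \<and> f a = v. g (f a))"
      using assms by (intro sum.group[symmetric]) auto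
    also have "\<dots> = (\<Sum>v=1..X. r v * g v)" by (intro sum.cong) (auto simp: r_def)
    finally show ?thesis .
  qed
  have "(\<Sum>a\<in>A. \<Sum>b\<in>A. k (f a) (f b)) = (\<Sum>v=1..X. \<Sum>w=1..X. r v * r w * k v w)"
    unfolding grp[of "k _"] grp[of "\<lambda>v. \<Sum>w=1..X. r w * k v w"]
    by (simp add: sum_distrib_left mult_ac)
  also have "\<dots> \<le> (\<Sum>v=1..X. \<Sum>w=1..X. (r v ^ 2 + r w ^ 2) / 2 * k v w)"
  proof (intro sum_mono mult_right_mono k0)
    fix v w show "r v * r w \<le> (r v ^ 2 + r w ^ 2) / 2"
      using sum_squares_bound[of "r v" "r w"] by simp
  qed
  also have "\<dots> = (\<Sum>v=1..X. \<Sum>w=1..X. r v ^ 2 * k v w) / 2 + (\<Sum>v=1..X. \<Sum>w=1..X. r w ^ 2 * k v w) / 2"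
    by (simp add: sum_divide_distrib algebra_simps add_divide_distrib sum.distrib)
  also have "(\<Sum>v=1..X. \<Sum>w=1..X. r w ^ 2 * k v w) = (\<Sum>v=1..X. \<Sum>w=1..X. r v ^ 2 * k v w)"
    by (subst sum.swap) (simp add: ksym)
  also have "(\<Sum>v=1..X. \<Sum>w=1..X. r v ^ 2 * k v w) / 2 + (\<Sum>v=1..X. \<Sum>w=1..X. r v ^ 2 * k v w) / 2
      = (\<Sum>v=1..X. r v ^ 2 * (\<Sum>w=1..X. k v w))"
    by (simp add: sum_distrib_left)
  also have "\<dots> \<le> (\<Sum>v=1..X. r v ^ 2 * (real (divisor_count v) * (1 + ln (real X))))"
    unfolding k_def by (intro sum_mono mult_left_mono sum_gcd_max_le assms) auto
  also have "\<dots> = (1 + ln (real X)) * (\<Sum>v=1..X. r v * (r v * real (divisor_count v)))"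
    by (simp add: sum_distrib_left power2_eq_square mult_ac)
  also have "\<dots> = (1 + ln (real X)) * (\<Sum>a\<in>A. r (f a) * real (divisor_count (f a)))"
    by (subst grp) simp
  finally show ?thesis by (simp add: r_def k_def)
qed

text \<open>The multiplicity in \<open>gcd_sum_le\<close> is O(\<tau>(v)) by
  \<open>card_pair_diff_fiber_le\<close>, which leaves the second moment of the divisor count; the
  values stay below a power of \<open>M\<close>, so the extra logarithm is that of
  \<open>M\<close>.\<close>

lemma gcd_sum_diff_pairs_le:
  fixes p :: "int poly"
  assumes "degree p \<ge> 2"
  shows "\<exists>C E. C \<ge> 0 \<and> (\<forall>M\<ge>2. (\<Sum>\<pi>\<in>diff_pairs p M. \<Sum>\<sigma>\<in>diff_pairs p M.
      real (gcd (nat \<bar>pair_diff p \<pi>\<bar>) (nat \<bar>pair_diff p \<sigma>\<bar>)) /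
      real (max (nat \<bar>pair_diff p \<pi>\<bar>) (nat \<bar>pair_diff p \<sigma>\<bar>)))
    \<le> C * real M ^ 2 * (1 + ln (real M)) ^ E)"
proof -
  obtain h where h: "\<And>M \<pi>. M \<ge> 2 \<Longrightarrow> \<pi> \<in> diff_pairs p M \<Longrightarrow> nat \<bar>pair_diff p \<pi>\<bar> \<le> M ^ h"
    using pair_diff_le_power by blast
  obtain C E where CE: "C \<ge> 0" "\<And>M. M \<ge> 2 \<Longrightarrow>
      (\<Sum>\<pi>\<in>diff_pairs p M. real (divisor_count (nat \<bar>pair_diff p \<pi>\<bar>)) ^ 2)
      \<le> C * real M ^ 2 * (1 + ln (real M)) ^ E"
    using sum_divisor_count_sq_le[of p] assms by auto
  define C' where "C' = real (Suc h) * (2 * real (degree p)) * C"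
  have "(\<Sum>\<pi>\<in>diff_pairs p M. \<Sum>\<sigma>\<in>diff_pairs p M.
      real (gcd (nat \<bar>pair_diff p \<pi>\<bar>) (nat \<bar>pair_diff p \<sigma>\<bar>)) /
      real (max (nat \<bar>pair_diff p \<pi>\<bar>) (nat \<bar>pair_diff p \<sigma>\<bar>)))
    \<le> C' * real M ^ 2 * (1 + ln (real M)) ^ Suc E" (is "?S \<le> _") if M: "M \<ge> 2" for M
  proof -
    let ?P = "diff_pairs p M" and ?v = "\<lambda>\<pi>. nat \<bar>pair_diff p \<pi>\<bar>"
    have ln0: "ln (real M) \<ge> 0" using M by simp
    have X: "ln (real (M ^ h)) \<le> real h * ln (real M)" using M by (simp add: ln_realpow)
    have "?S \<le> (1 + ln (real (M ^ h))) *
        (\<Sum>\<pi>\<in>?P. real (card {\<sigma> \<in> ?P. ?v \<sigma> = ?v \<pi>}) * real (divisor_count (?v \<pi>)))"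
    proof (rule gcd_sum_le[OF finite_diff_pairs])
      fix \<pi> assume "\<pi> \<in> ?P"
      then show "?v \<pi> \<in> {1..M ^ h}" using h[OF M] pair_diff_nonzero[of \<pi> p M] by auto
    qed (use M in simp)
    also have "\<dots> \<le> (real (Suc h) * (1 + ln (real M))) *
        (\<Sum>\<pi>\<in>?P. real (2 * degree p * divisor_count (?v \<pi>)) * real (divisor_count (?v \<pi>)))"
    proof (intro mult_mono sum_mono)
      have "1 + real h * ln (real M) \<le> real (Suc h) * (1 + ln (real M))"
        using ln0 by (simp add: algebra_simps)
      then show "1 + ln (real (M ^ h)) \<le> real (Suc h) * (1 + ln (real M))" using X by linarith
      fix \<pi> assume "\<pi> \<in> ?P"
      then have "?v \<pi> > 0" using pair_diff_nonzero by simp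
      then show "real (card {\<sigma> \<in> ?P. ?v \<sigma> = ?v \<pi>}) \<le> real (2 * degree p * divisor_count (?v \<pi>))"
        using card_pair_diff_fiber_le[OF assms] by (simp only: of_nat_le_iff)
    qed (use ln0 in \<open>auto intro!: sum_nonneg\<close>)
    also have "\<dots> = real (Suc h) * (1 + ln (real M)) * (2 * real (degree p)) *
        (\<Sum>\<pi>\<in>?P. real (divisor_count (?v \<pi>)) ^ 2)"
      unfolding sum_distrib_left by (intro sum.cong refl) (simp add: power2_eq_square)
    also have "\<dots> \<le> real (Suc h) * (1 + ln (real M)) * (2 * real (degree p)) *
        (C * real M ^ 2 * (1 + ln (real M)) ^ E)"
      using ln0 by (intro mult_left_mono CE(2) M) auto
    also have "\<dots> = C' * real M ^ 2 * (1 + ln (real M)) ^ Suc E"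
      unfolding C'_def power_Suc by (simp only: mult_ac)
    finally show ?thesis .
  qed
  moreover have "C' \<ge> 0" using CE(1) by (simp add: C'_def)
  ultimately show ?thesis by blast
qed

section \<open>Correlations of centred window counts\<close>

definition unit_measure :: "real measure" where
  "unit_measure = restrict_space lborel {0..1}"

lemma space_unit_measure [simp]: "space unit_measure = {0..1}"
  by (simp add: unit_measure_def space_restrict_space)

lemma measurable_unit_measureI: "f \<in> borel_measurable borel \<Longrightarrow> f \<in> borel_measurable unit_measure"
  unfolding unit_measure_def by (intro measurable_restrict_space1) simp

lemma finite_measure_unit_measure: "finite_measure unit_measure"
  by (rule finite_measureI) (simp add: unit_measure_def emeasure_restrict_space space_restrict_space)

interpretation unit_measure: finite_measure unit_measure
  by (rule finite_measure_unit_measure)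

lemma measure_unit_measure: "measure unit_measure {0..1} = 1"
  by (simp add: unit_measure_def measure_restrict_space)

lemma integral_unit_measure: "integral\<^sup>L unit_measure f = (LINT x:{0..1}|lborel. (f x :: real))"
  unfolding unit_measure_def set_lebesgue_integral_def by (rule integral_restrict_space) simp

lemma integrable_unit_measure:
  fixes f :: "real \<Rightarrow> real"
  assumes "f \<in> borel_measurable borel" "\<And>x. \<bar>f x\<bar> \<le> K"
  shows "integrable unit_measure f"
  by (rule unit_measure.integrable_const_bound[of f K])
    (use assms in \<open>auto intro: measurable_unit_measureI\<close>)

lemma set_integrable_bounded:
  fixes f :: "real \<Rightarrow> real"
  assumes "f \<in> borel_measurable borel" "\<And>x. \<bar>f x\<bar> \<le> K"
  shows "set_integrable lborel {a..b} f"
proof -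
  have "set_integrable lborel {a..b} (\<lambda>x. K)"
    unfolding set_integrable_def by (intro integrable_scaleR_left integrable_real_indicator) (auto simp: emeasure_lborel_Icc_eq)
  then show ?thesis
    using assms by (elim set_integrable_bound) (auto simp: set_borel_measurable_def intro: order_trans[OF _ abs_ge_self])
qed

text \<open>Translation invariance on the circle: periodicity reduces \<open>c\<close> to its
  fractional part \<open>d\<close>, and the piece of \<open>{d..1 + d}\<close> beyond 1 is moved
  back to \<open>{0..d}\<close>.\<close>

lemma integral_unit_measure_shift:
  fixes f :: "real \<Rightarrow> real"
  assumes [measurable]: "f \<in> borel_measurable borel" and bd: "\<And>x. \<bar>f x\<bar> \<le> K"
    and per: "\<And>x. f (x + 1) = f x"
  shows "(\<integral>x. f (x + c) \<partial>unit_measure) = (\<integral>x. f x \<partial>unit_measure)"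
proof -
  have per': "f (x + real_of_int k) = f x" for x k
  proof (induction k rule: int_induct[where k = 0])
    case (step1 i)
    then show ?case using per[of "x + real_of_int i"] by (simp add: add.assoc)
  next
    case (step2 i)
    then show ?case using per[of "x + real_of_int (i - 1)"] by simp
  qed simp
  define d where "d = frac c"
  have d: "0 \<le> d" "d \<le> 1" unfolding d_def using frac_lt_1[of c] by (auto intro: less_imp_le)
  have fc: "f (x + c) = f (x + d)" for x
    using per'[of "x + d" "\<lfloor>c\<rfloor>"] by (simp add: d_def frac_def)
  have I: "f integrable_on {a..b}" for a b
    using set_borel_integral_eq_integral(1)[OF set_integrable_bounded[OF assms(1) bd]] .
  have "(\<integral>x. f (x + c) \<partial>unit_measure) = integral {0..1} (\<lambda>x. f (x + d))"
    unfolding integral_unit_measure fc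
    by (rule set_borel_integral_eq_integral(2)[OF set_integrable_bounded]) (use bd in auto)
  also have "\<dots> = integral {d..1 + d} f"
    using integral_shift_real_ivl[of d d "1 + d" f] by simp
  also have "\<dots> = integral {d..1} f + integral {1..1 + d} f"
    using d by (intro Henstock_Kurzweil_Integration.integral_combine[symmetric] I) auto
  also have "integral {1..1 + d} f = integral {0..d} (\<lambda>x. f (x + 1))"
    using integral_shift_real_ivl[of 1 1 "1 + d" f] by simp
  also have "\<dots> = integral {0..d} f" by (simp add: per)
  also have "integral {d..1} f + integral {0..d} f = integral {0..1} f"
    using d by (subst add.commute) (intro Henstock_Kurzweil_Integration.integral_combine I, auto)
  also have "\<dots> = (\<integral>x. f x \<partial>unit_measure)"
    unfolding integral_unit_measure
    by (rule set_borel_integral_eq_integral(2)[OF set_integrable_bounded[OF assms(1) bd], symmetric])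
  finally show ?thesis .
qed

section \<open>The centred window count and its mean\<close>

text \<open>The number of integers \<open>j\<close> with \<open>-s \<le> u + j < s\<close>, minus its mean value over \<open>u\<close>.\<close>

definition window :: "real \<Rightarrow> real \<Rightarrow> real" where
  "window s u = real_of_int \<lfloor>u + s\<rfloor> - real_of_int \<lfloor>u - s\<rfloor> - 2 * s"

lemma window_eq_frac: "window s u = frac (u - s) - frac (u + s)"
  by (simp add: window_def frac_def)

lemma abs_window_le_1: "\<bar>window s u\<bar> \<le> 1"
  using frac_ge_0[of "u - s"] frac_ge_0[of "u + s"] frac_lt_1[of "u - s"] frac_lt_1[of "u + s"]
  unfolding window_eq_frac by linarith

lemma window_add_int: "window s (u + real_of_int k) = window s u"
proof -
  have "\<lfloor>u + real_of_int k + s\<rfloor> = \<lfloor>u + s\<rfloor> + k" "\<lfloor>u + real_of_int k - s\<rfloor> = \<lfloor>u - s\<rfloor> + k"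
    by linarith+
  then show ?thesis by (simp add: window_def)
qed

text \<open>The count is nonnegative, so \<open>window\<close> is at least \<open>- 2 * s\<close>.
  As its mean is zero, this majorant gives an L1 norm of at most \<open>4 * s\<close> without any
  computation of the integral.\<close>

lemma abs_window_le:
  assumes "s \<ge> 0"
  shows "\<bar>window s u\<bar> \<le> window s u + 4 * s"
proof -
  have "\<lfloor>u - s\<rfloor> \<le> \<lfloor>u + s\<rfloor>" using assms by (intro floor_mono) simp
  then have "window s u \<ge> - 2 * s" by (simp add: window_def)
  then show ?thesis using assms by linarith
qed

lemma borel_measurable_window_affine [measurable]:
  "(\<lambda>x. window s (x * a + b)) \<in> borel_measurable borel"
  unfolding window_def by measurable

text \<open>The window is a difference of two fractional parts, and translating the variable by
  \<open>d / v\<close> shows that both have the same integral.\<close>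

lemma integral_window_affine:
  fixes v :: int
  assumes "v \<noteq> 0"
  shows "(\<integral>x. window s (x * real_of_int v + c) \<partial>unit_measure) = 0"
proof -
  let ?f = "\<lambda>x. frac (x * real_of_int v)"
  have m [measurable]: "(\<lambda>x. frac (x * real_of_int v + d)) \<in> borel_measurable borel" for d
    unfolding frac_def by measurable
  have bd: "\<bar>frac (y :: real)\<bar> \<le> 1" for y using frac_lt_1[of y] by simp
  have sh: "(\<integral>x. frac (x * real_of_int v + d) \<partial>unit_measure) = (\<integral>x. ?f x \<partial>unit_measure)" for d
  proof -
    have "(\<integral>x. ?f (x + d / real_of_int v) \<partial>unit_measure) = (\<integral>x. ?f x \<partial>unit_measure)"
    proof (rule integral_unit_measure_shift[OF _ bd])
      fix x have "?f (x + 1) = frac (x * real_of_int v + real_of_int v)" by (simp add: algebra_simps)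
      also have "\<dots> = ?f x" unfolding frac_def by simp
      finally show "?f (x + 1) = ?f x" .
    qed (use m[of 0] in simp)
    then show ?thesis using assms by (simp add: algebra_simps)
  qed
  have int: "integrable unit_measure (\<lambda>x. frac (x * real_of_int v + d))" for d
    by (rule integrable_unit_measure[OF m bd])
  show ?thesis
    unfolding window_eq_frac
    using int[of "c - s"] int[of "c + s"] sh[of "c - s"] sh[of "c + s"]
    by (simp add: add.assoc add_diff_eq[symmetric])
qed

section \<open>Hermite's identity and equally spaced translates\<close>

text \<open>Raising \<open>N\<close> by one trades the term \<open>N div n\<close> for
  \<open>(N + n) div n\<close>, so the sum grows by exactly one.\<close>

lemma sum_div_shift:
  fixes N :: int and n :: nat
  assumes "n > 0"
  shows "(\<Sum>k<n. (N + int k) div int n) = N"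
proof -
  define S where "S N = (\<Sum>k<n. (N + int k) div int n)" for N
  have step: "S (N + 1) = S N + 1" for N
  proof -
    have "S (N + 1) + N div int n = (\<Sum>k<Suc n. (N + int k) div int n)"
      unfolding sum.lessThan_Suc_shift S_def by (simp add: ac_simps)
    also have "\<dots> = S N + (N div int n + 1)" using assms by (simp add: S_def)
    finally show ?thesis by simp
  qed
  have "S N = N"
  proof (induction N rule: int_induct[where k = 0])
    case base
    show ?case by (simp add: S_def)
  next
    case (step1 i)
    then show ?case using step by simp
  next
    case (step2 i)
    then show ?case using step[of "i - 1"] by simp
  qed
  then show ?thesis by (simp add: S_def)
qed

lemma hermite_identity:
  assumes "n > 0"
  shows "(\<Sum>k<n. \<lfloor>t + real k / real n\<rfloor>) = \<lfloor>real n * t\<rfloor>"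
proof -
  have "\<lfloor>t + real k / real n\<rfloor> = (\<lfloor>real n * t\<rfloor> + int k) div int n" for k
  proof -
    have "t + real k / real n = (real n * t + real k) / real_of_int (int n)"
      using assms by (simp add: field_simps)
    then have "\<lfloor>t + real k / real n\<rfloor> = \<lfloor>real n * t + real k\<rfloor> div int n"
      by (simp only: floor_divide_real_eq_div of_nat_0_le_iff)
    also have "\<lfloor>real n * t + real k\<rfloor> = \<lfloor>real n * t\<rfloor> + int k"
      using floor_add_int[of "real n * t" "int k"] by simp
    finally show ?thesis .
  qed
  then show ?thesis using sum_div_shift[OF assms] by simp
qed

text \<open>This is the source of cancellation: \<open>n\<close> equally spaced windows add up to a
  single centred window, which is bounded by 1 rather than by \<open>n\<close>.\<close>

lemma sum_window_shifts:
  assumes "n > 0"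
  shows "(\<Sum>k<n. window s (t + real k / real n)) = window (real n * s) (real n * t)"
proof -
  have "(\<Sum>k<n. window s (t + real k / real n)) =
      real_of_int (\<Sum>k<n. \<lfloor>(t + s) + real k / real n\<rfloor>) -
      real_of_int (\<Sum>k<n. \<lfloor>(t - s) + real k / real n\<rfloor>) - 2 * (real n * s)"
    unfolding window_def by (simp add: sum_subtractf add_ac diff_add_eq)
  then show ?thesis
    unfolding hermite_identity[OF assms] by (simp add: window_def algebra_simps)
qed

text \<open>Multiplication by \<open>b\<close> permutes the residues modulo \<open>n\<close>, and
  windows have period 1.\<close>

lemma sum_window_coprime_shifts:
  fixes b :: int
  assumes "n > 0" "coprime b (int n)"
  shows "(\<Sum>k<n. window s (t + real_of_int b * real k / real n)) = window (real n * s) (real n * t)"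
proof -
  let ?h = "\<lambda>k. nat ((b * int k) mod int n)"
  have inj: "inj_on ?h {..<n}"
  proof (rule inj_onI)
    fix x y assume xy: "x \<in> {..<n}" "y \<in> {..<n}" "?h x = ?h y"
    then have "(b * int x) mod int n = (b * int y) mod int n"
      using assms(1) by (simp add: nat_eq_iff)
    then have "int n dvd b * (int x - int y)" by (simp add: mod_eq_dvd_iff right_diff_distrib)
    then have "int n dvd int x - int y"
      using assms(2) by (simp add: coprime_dvd_mult_right_iff coprime_commute)
    then have "int x mod int n = int y mod int n" by (simp add: mod_eq_dvd_iff)
    then show "x = y" using xy by simp
  qed
  have "?h ` {..<n} \<subseteq> {..<n}" using assms(1) by (auto simp: nat_less_iff)
  then have im: "?h ` {..<n} = {..<n}" by (intro endo_inj_surj inj) auto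
  have w: "window s (t + real_of_int b * real k / real n) = window s (t + real (?h k) / real n)" for k
  proof -
    have "b * int k = (b * int k) div int n * int n + (b * int k) mod int n" by simp
    then have "real_of_int (b * int k) =
        real_of_int ((b * int k) div int n) * real n + real_of_int ((b * int k) mod int n)"
      by (metis of_int_add of_int_mult of_int_of_nat_eq)
    then have "t + real_of_int b * real k / real n =
        t + real_of_int ((b * int k) mod int n) / real n + real_of_int ((b * int k) div int n)"
      using assms(1) by (simp add: field_simps)
    then have "window s (t + real_of_int b * real k / real n) =
        window s (t + real_of_int ((b * int k) mod int n) / real n)" by (simp only: window_add_int)
    then show ?thesis using assms(1) by simp
  qed
  have "(\<Sum>k<n. window s (t + real_of_int b * real k / real n)) = (\<Sum>k<n. window s (t + real (?h k) / real n))"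
    by (simp only: w)
  also have "\<dots> = (\<Sum>k\<in>?h ` {..<n}. window s (t + real k / real n))"
    by (simp add: sum.reindex[OF inj])
  finally show ?thesis unfolding im sum_window_shifts[OF assms(1)] .
qed

text \<open>Translating \<open>\<alpha>\<close> by \<open>k / |v|\<close> fixes the first factor. With \<open>n = |v| / gcd v w\<close>, the average
  of the second factor over \<open>k < n\<close> is at most \<open>1 / n\<close>, because the translates are equally
  spaced.\<close>

lemma window_correlation_le_aux:
  fixes v w :: int
  assumes "v \<noteq> 0" "s \<ge> 0"
  shows "\<bar>\<integral>\<alpha>. window s (\<alpha> * real_of_int v) * window s (\<alpha> * real_of_int w) \<partial>unit_measure\<bar>
    \<le> 4 * s * real_of_int (gcd v w) / \<bar>real_of_int v\<bar>"
proof -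
  define g where "g = gcd v w"
  define n where "n = nat (\<bar>v\<bar> div g)"
  define b where "b = w div g"
  have g: "g > 0" using assms(1) by (simp add: g_def)
  have gv: "g dvd \<bar>v\<bar>" and gw: "g dvd w" by (simp_all add: g_def)
  have vn: "\<bar>v\<bar> = g * int n" using gv g pos_imp_zdiv_nonneg_iff[OF g, of "\<bar>v\<bar>"] unfolding n_def by simp
  have wb: "w = g * b" using gw by (simp add: b_def)
  have n: "n > 0"
  proof (rule ccontr)
    assume "\<not> n > 0"
    then show False using vn assms(1) by simp
  qed
  have cop: "coprime b (int n)"
  proof -
    have "gcd \<bar>v\<bar> w = g" by (simp add: g_def)
    then have "gcd (g * int n) (g * b) = g" using vn wb by metis
    then have "g * gcd (int n) b = g" using g by (simp add: gcd_mult_distrib_int[symmetric])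
    then have "gcd (int n) b = 1" using g by simp
    then show ?thesis by (simp add: coprime_iff_gcd_eq_1 gcd.commute)
  qed
  let ?f = "\<lambda>\<alpha>. window s (\<alpha> * real_of_int v) * window s (\<alpha> * real_of_int w)"
  have m [measurable]: "(\<lambda>x. window s (x * a)) \<in> borel_measurable borel" for a
    using borel_measurable_window_affine[of s a 0] by simp
  have bd: "\<bar>window s x * window s' y\<bar> \<le> 1" for x y s'
    unfolding abs_mult using mult_mono[OF abs_window_le_1[of s x] abs_window_le_1[of s' y]] by simp
  have shift: "(\<integral>\<alpha>. ?f \<alpha> \<partial>unit_measure) =
      (\<integral>\<alpha>. window s (\<alpha> * real_of_int v) *
        window s (\<alpha> * real_of_int w + real_of_int b * real k / real n) \<partial>unit_measure)" for k
  proof -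
    have "(\<integral>\<alpha>. ?f (\<alpha> + real k / \<bar>real_of_int v\<bar>) \<partial>unit_measure) = (\<integral>\<alpha>. ?f \<alpha> \<partial>unit_measure)"
    proof (rule integral_unit_measure_shift[OF _ bd])
      fix x show "?f (x + 1) = ?f x"
        using window_add_int[of s "x * real_of_int v" v] window_add_int[of s "x * real_of_int w" w]
        by (simp add: algebra_simps)
    qed measurable
    moreover have "?f (\<alpha> + real k / \<bar>real_of_int v\<bar>) = window s (\<alpha> * real_of_int v) *
        window s (\<alpha> * real_of_int w + real_of_int b * real k / real n)" for \<alpha>
    proof -
      have "(\<alpha> + real k / \<bar>real_of_int v\<bar>) * real_of_int v = \<alpha> * real_of_int v + real_of_int (sgn v * int k)"
        using assms(1) by (cases "v > 0") (simp_all add: field_simps)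
      moreover have "(\<alpha> + real k / \<bar>real_of_int v\<bar>) * real_of_int w =
          \<alpha> * real_of_int w + real_of_int b * real k / real n"
      proof -
        have "\<bar>real_of_int v\<bar> = real_of_int g * real n" using vn
          by (metis of_int_abs of_int_mult of_int_of_nat_eq)
        then show ?thesis using g n by (simp add: wb field_simps)
      qed
      ultimately show ?thesis by (simp only: window_add_int)
    qed
    ultimately show ?thesis by simp
  qed
  have "real n * (\<integral>\<alpha>. ?f \<alpha> \<partial>unit_measure) = (\<Sum>k<n. \<integral>\<alpha>. ?f \<alpha> \<partial>unit_measure)" by simp
  also have "\<dots> = (\<Sum>k<n. \<integral>\<alpha>. window s (\<alpha> * real_of_int v) *
        window s (\<alpha> * real_of_int w + real_of_int b * real k / real n) \<partial>unit_measure)"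
    by (intro sum.cong refl shift)
  also have "\<dots> = (\<integral>\<alpha>. (\<Sum>k<n. window s (\<alpha> * real_of_int v) *
        window s (\<alpha> * real_of_int w + real_of_int b * real k / real n)) \<partial>unit_measure)"
    by (intro Bochner_Integration.integral_sum[symmetric] integrable_unit_measure[OF _ bd]) measurable
  also have "\<dots> = (\<integral>\<alpha>. window s (\<alpha> * real_of_int v) *
      window (real n * s) (real n * (\<alpha> * real_of_int w)) \<partial>unit_measure)"
    by (simp only: sum_distrib_left[symmetric] sum_window_coprime_shifts[OF n cop])
  finally have eq: "real n * (\<integral>\<alpha>. ?f \<alpha> \<partial>unit_measure) = \<dots>" .
  have m2 [measurable]: "(\<lambda>\<alpha>. window (real n * s) (real n * (\<alpha> * real_of_int w))) \<in> borel_measurable borel"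
    unfolding window_def by measurable
  have "\<bar>real n * (\<integral>\<alpha>. ?f \<alpha> \<partial>unit_measure)\<bar> \<le> (\<integral>\<alpha>. \<bar>window s (\<alpha> * real_of_int v) *
      window (real n * s) (real n * (\<alpha> * real_of_int w))\<bar> \<partial>unit_measure)"
    unfolding eq by (rule integral_abs_bound)
  \<comment> \<open>The second factor is bounded by 1; the first is replaced by the majorant of
    \<open>abs_window_le\<close>, whose integral is \<open>4 * s\<close> by the vanishing
    mean.\<close>
  also have "\<dots> \<le> (\<integral>\<alpha>. window s (\<alpha> * real_of_int v) + 4 * s \<partial>unit_measure)"
  proof (rule integral_mono)
    show "integrable unit_measure (\<lambda>\<alpha>. \<bar>window s (\<alpha> * real_of_int v) *
        window (real n * s) (real n * (\<alpha> * real_of_int w))\<bar>)"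
      by (rule integrable_unit_measure[of _ 1]) (use bd in auto)
    show "integrable unit_measure (\<lambda>\<alpha>. window s (\<alpha> * real_of_int v) + 4 * s)"
      by (intro Bochner_Integration.integrable_add integrable_unit_measure[OF _ abs_window_le_1]) auto
  next
    fix \<alpha>
    have "\<bar>window s (\<alpha> * real_of_int v) * window (real n * s) (real n * (\<alpha> * real_of_int w))\<bar>
        \<le> \<bar>window s (\<alpha> * real_of_int v)\<bar> * 1"
      unfolding abs_mult by (intro mult_left_mono abs_window_le_1) auto
    then show "\<bar>window s (\<alpha> * real_of_int v) * window (real n * s) (real n * (\<alpha> * real_of_int w))\<bar>
        \<le> window s (\<alpha> * real_of_int v) + 4 * s"
      using abs_window_le[OF assms(2), of "\<alpha> * real_of_int v"] by simp
  qed
  also have "\<dots> = 4 * s"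
    using integral_window_affine[OF assms(1), of s 0]
    by (subst Bochner_Integration.integral_add)
      (auto intro!: integrable_unit_measure[OF _ abs_window_le_1] simp: measure_unit_measure)
  finally have "real n * \<bar>\<integral>\<alpha>. ?f \<alpha> \<partial>unit_measure\<bar> \<le> 4 * s" by (simp add: abs_mult)
  then have "\<bar>\<integral>\<alpha>. ?f \<alpha> \<partial>unit_measure\<bar> \<le> 4 * s / real n" using n by (simp add: field_simps)
  also have "\<dots> = 4 * s * real_of_int g / \<bar>real_of_int v\<bar>"
  proof -
    have "\<bar>real_of_int v\<bar> = real_of_int g * real n" using vn
      by (metis of_int_abs of_int_mult of_int_of_nat_eq)
    then show ?thesis using g by simp
  qed
  finally show ?thesis by (simp add: g_def)
qed

text \<open>The auxiliary bound is asymmetric; giving the first role to the integer of larger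
  absolute value puts the maximum in the denominator.\<close>

lemma window_correlation_le:
  fixes v w :: int
  assumes "v \<noteq> 0" "w \<noteq> 0" "s \<ge> 0"
  shows "\<bar>\<integral>\<alpha>. window s (\<alpha> * real_of_int v) * window s (\<alpha> * real_of_int w) \<partial>unit_measure\<bar>
    \<le> 4 * s * (real (gcd (nat \<bar>v\<bar>) (nat \<bar>w\<bar>)) / real (max (nat \<bar>v\<bar>) (nat \<bar>w\<bar>)))"
proof -
  have g: "real (gcd (nat \<bar>v\<bar>) (nat \<bar>w\<bar>)) = real_of_int (gcd v w)"
    unfolding gcd_int_def by (simp only: of_int_of_nat_eq)
  show ?thesis
  proof (cases "\<bar>w\<bar> \<le> \<bar>v\<bar>")
    case True
    then have "real (max (nat \<bar>v\<bar>) (nat \<bar>w\<bar>)) = \<bar>real_of_int v\<bar>" by (simp add: max_absorb1 nat_mono)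
    then show ?thesis using window_correlation_le_aux[OF assms(1,3), of w] by (simp only: g times_divide_eq_right)
  next
    case False
    then have mx: "real (max (nat \<bar>v\<bar>) (nat \<bar>w\<bar>)) = \<bar>real_of_int w\<bar>" by (simp add: max_def)
    have swap: "(\<integral>\<alpha>. window s (\<alpha> * real_of_int v) * window s (\<alpha> * real_of_int w) \<partial>unit_measure) =
        (\<integral>\<alpha>. window s (\<alpha> * real_of_int w) * window s (\<alpha> * real_of_int v) \<partial>unit_measure)"
      by (intro Bochner_Integration.integral_cong refl mult.commute)
    show ?thesis
      unfolding g mx times_divide_eq_right swap gcd.commute[of v w]
      by (rule window_correlation_le_aux[OF assms(2,3)])
  qed
qed

section \<open>The number variance as a pair sum\<close>

text \<open>The contributing \<open>j\<close> fill the integer interval \<open>?A\<close>. Because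
  the window is half-open, the difference of floors is exact at the endpoints as well.\<close>

lemma infsum_indicator_shift:
  assumes "S \<ge> 0"
  shows "(\<Sum>\<^sub>\<infinity>j\<in>(UNIV :: int set). indicator {- S / 2 ..< S / 2} (t + real_of_int j)) = window (S / 2) t + S"
proof -
  let ?A = "{- \<lfloor>t + S / 2\<rfloor> ..< - \<lfloor>t - S / 2\<rfloor>}"
  have mem: "- S / 2 \<le> t + real_of_int j \<and> t + real_of_int j < S / 2 \<longleftrightarrow> j \<in> ?A" for j
    by auto linarith+
  have "(\<Sum>\<^sub>\<infinity>j\<in>(UNIV :: int set). indicator {- S / 2 ..< S / 2} (t + real_of_int j)) =
      (\<Sum>\<^sub>\<infinity>j\<in>?A. (1 :: real))"
    by (rule infsum_cong_neutral) (use mem in \<open>auto simp: indicator_def\<close>)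
  also have "\<dots> = real (card ?A)" by (subst infsum_finite) simp_all
  also have "\<dots> = real_of_int (\<lfloor>t + S / 2\<rfloor> - \<lfloor>t - S / 2\<rfloor>)"
  proof -
    have "\<lfloor>t - S / 2\<rfloor> \<le> \<lfloor>t + S / 2\<rfloor>" using assms by (intro floor_mono) simp
    then show ?thesis by simp
  qed
  finally show ?thesis by (simp add: window_def)
qed

lemma count_near_eq:
  assumes "S \<ge> 0"
  shows "count_near x \<alpha> N S y = (\<Sum>n=1..N. window (S / 2) (\<alpha> * real_of_int (x n) - y)) + real N * S"
  unfolding count_near_def infsum_indicator_shift[OF assms] by (simp add: sum.distrib)

lemma set_integral_reflect:
  fixes F :: "real \<Rightarrow> real"
  shows "(LINT y:{0..S}|lborel. F (S - y)) = (LINT y:{0..S}|lborel. F y)"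
proof -
  have "(LINT y:{0..S}|lborel. F y) = (\<integral>y. indicator {0..S} (S + - 1 * y) *\<^sub>R F (S + - 1 * y) \<partial>lborel)"
    unfolding set_lebesgue_integral_def
    by (subst lborel_integral_real_affine[where c = "- 1" and t = S]) simp_all
  also have "\<dots> = (LINT y:{0..S}|lborel. F (S - y))"
    unfolding set_lebesgue_integral_def
    by (intro Bochner_Integration.integral_cong refl) (auto simp: indicator_def)
  finally show ?thesis by simp
qed

lemma borel_measurable_window_reflect [measurable]: "(\<lambda>y. window s (a - y)) \<in> borel_measurable borel"
  unfolding window_def by measurable

lemma borel_measurable_window_fst [measurable]: "(\<lambda>s. window s u) \<in> borel_measurable borel"
  unfolding window_def by measurable

lemma abs_window_mult_le_1: "\<bar>window s x * window t y\<bar> \<le> 1"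
  unfolding abs_mult using mult_mono[OF abs_window_le_1[of s x] abs_window_le_1[of t y]] by simp

text \<open>After a translation the second window is \<open>indicator {0..S} y - S\<close> almost
  everywhere on the unit interval; the constant is killed by the mean zero of the first window,
  which leaves the integral of the first window over \<open>{0..S}\<close>. A reflection turns this
  into an average over radii.\<close>

lemma window_autocorrelation:
  assumes "0 \<le> S" "S < 1"
  shows "(\<integral>y. window (S / 2) (a - y) * window (S / 2) (b - y) \<partial>unit_measure) =
    (LINT s:{0..S}|lborel. window s (a - b))"
proof -
  define u h where "u = a - b" and "h = S / 2"
  let ?g = "\<lambda>y. window h (u + h - y)"
  have "(\<integral>y. window h (a - y) * window h (b - y) \<partial>unit_measure) =
      (\<integral>y. window h (a - (y + (b - h))) * window h (b - (y + (b - h))) \<partial>unit_measure)"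
  proof (rule integral_unit_measure_shift[OF _ abs_window_mult_le_1, symmetric])
    fix y show "window h (a - (y + 1)) * window h (b - (y + 1)) = window h (a - y) * window h (b - y)"
      using window_add_int[of h "a - y" "- 1"] window_add_int[of h "b - y" "- 1"]
      by (simp add: algebra_simps)
  qed measurable
  also have "\<dots> = (\<integral>y. ?g y * window h (h - y) \<partial>unit_measure)"
    by (intro Bochner_Integration.integral_cong refl) (simp add: u_def algebra_simps)
  also have "\<dots> = (\<integral>y. ?g y * indicator {0..S} y - S * ?g y \<partial>unit_measure)"
  proof (rule integral_cong_AE)
    show "AE y in unit_measure. ?g y * window h (h - y) = ?g y * indicator {0..S} y - S * ?g y"
      unfolding unit_measure_def
    proof (subst AE_restrict_space_iff)
      show "AE y in lborel. y \<in> {0..1} \<longrightarrow> ?g y * window h (h - y) = ?g y * indicator {0..S} y - S * ?g y"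
        using AE_lborel_singleton[of 0]
      proof eventually_elim
        fix y :: real assume "y \<noteq> 0"
        show "y \<in> {0..1} \<longrightarrow> ?g y * window h (h - y) = ?g y * indicator {0..S} y - S * ?g y"
        proof
          assume "y \<in> {0..1}"
          then have y: "0 < y" "y \<le> 1" using \<open>y \<noteq> 0\<close> by auto
          \<comment> \<open>This fails at \<open>y = 0\<close>, which is why that null set was set
            aside.\<close>
          have "\<lfloor>- y\<rfloor> = - 1" using y by linarith
          moreover have "\<lfloor>S - y\<rfloor> = (if y \<le> S then 0 else - 1)" using y assms by (simp; linarith)
          ultimately have "window h (h - y) = indicator {0..S} y - S"
            using y by (simp add: window_def h_def indicator_def)
          then show "?g y * window h (h - y) = ?g y * indicator {0..S} y - S * ?g y"
            by (simp only: right_diff_distrib mult.commute[of S "?g y"])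
        qed
      qed
    qed simp
  qed (auto intro!: measurable_unit_measureI)
  also have "\<dots> = (\<integral>y. ?g y * indicator {0..S} y \<partial>unit_measure) - S * (\<integral>y. ?g y \<partial>unit_measure)"
  proof (subst Bochner_Integration.integral_diff)
    show "integrable unit_measure (\<lambda>y. ?g y * indicator {0..S} y)"
      by (rule integrable_unit_measure[of _ 1]) (auto simp: indicator_def abs_window_le_1)
    show "integrable unit_measure (\<lambda>y. S * ?g y)"
      by (intro integrable_mult_right integrable_unit_measure[OF _ abs_window_le_1]) measurable
  qed simp
  also have "(\<integral>y. ?g y \<partial>unit_measure) = 0"
    using integral_window_affine[of "- 1" h "u + h"] by (simp add: algebra_simps)
  also have "(\<integral>y. ?g y * indicator {0..S} y \<partial>unit_measure) = (LINT y:{0..S}|lborel. ?g y)"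
    unfolding integral_unit_measure set_lebesgue_integral_def
    using assms by (intro Bochner_Integration.integral_cong refl) (auto simp: indicator_def)
  also have "\<dots> = (LINT s:{0..S}|lborel. window s u)"
  proof -
    \<comment> \<open>The shifted window equals \<open>F (S - y) - G y\<close>. Reflecting only the
      first summand pairs the floors at \<open>u + y\<close> and \<open>u - y\<close>, which is
      \<open>window y u\<close>.\<close>
    define F G where "F y = real_of_int \<lfloor>u + y\<rfloor> - y" and "G y = real_of_int \<lfloor>u - y\<rfloor> + y" for y
    have m [measurable]: "F \<in> borel_measurable borel" "G \<in> borel_measurable borel"
      unfolding F_def G_def by measurable
    have "\<bar>F y\<bar> \<le> \<bar>u\<bar> + 1" "\<bar>G y\<bar> \<le> \<bar>u\<bar> + 1" for y
      unfolding F_def G_def by linarith+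
    then have int: "set_integrable lborel {0..S} F" "set_integrable lborel {0..S} (\<lambda>y. F (S - y))"
        "set_integrable lborel {0..S} G"
      by (auto intro!: set_integrable_bounded[of _ "\<bar>u\<bar> + 1"])
    have "(LINT y:{0..S}|lborel. ?g y) = (LINT y:{0..S}|lborel. F (S - y) - G y)"
      by (rule set_lebesgue_integral_cong) (auto simp: F_def G_def window_def h_def algebra_simps)
    also have "\<dots> = (LINT y:{0..S}|lborel. F y) - (LINT y:{0..S}|lborel. G y)"
      by (simp add: set_integral_diff(2)[OF int(2,3)] set_integral_reflect)
    also have "\<dots> = (LINT y:{0..S}|lborel. F y - G y)"
      by (simp add: set_integral_diff(2)[OF int(1,3)])
    also have "\<dots> = (LINT s:{0..S}|lborel. window s u)"
      by (rule set_lebesgue_integral_cong) (auto simp: F_def G_def window_def algebra_simps)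
    finally show ?thesis .
  qed
  finally show ?thesis by (simp add: u_def h_def)
qed

text \<open>Write the count as its mean \<open>N * S\<close> plus a sum of centred windows: the
  linear term integrates to zero and the square of the mean cancels.\<close>

lemma number_variance_eq:
  assumes "0 \<le> S" "S < 1"
  shows "number_variance x N S \<alpha> =
    (\<Sum>n=1..N. \<Sum>m=1..N. \<integral>y. window (S / 2) (\<alpha> * real_of_int (x n) - y) *
      window (S / 2) (\<alpha> * real_of_int (x m) - y) \<partial>unit_measure)"
proof -
  let ?w = "\<lambda>n y. window (S / 2) (\<alpha> * real_of_int (x n) - y)"
  have w0: "(\<integral>y. ?w n y \<partial>unit_measure) = 0" for n
    using integral_window_affine[of "- 1" "S / 2" "\<alpha> * real_of_int (x n)"] by (simp add: algebra_simps)
  have i1: "integrable unit_measure (?w n)" for n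
    by (rule integrable_unit_measure[OF _ abs_window_le_1]) measurable
  have i2: "integrable unit_measure (\<lambda>y. ?w n y * ?w m y)" for n m
    by (rule integrable_unit_measure[OF _ abs_window_mult_le_1]) measurable
  have i3: "integrable unit_measure (\<lambda>y. (\<Sum>n=1..N. \<Sum>m=1..N. ?w n y * ?w m y))"
    by (intro Bochner_Integration.integrable_sum i2)
  have i4: "integrable unit_measure (\<lambda>y. 2 * (real N * S) * (\<Sum>n=1..N. ?w n y))"
    by (intro integrable_mult_right Bochner_Integration.integrable_sum i1)
  have "(LINT y:{0..1}|lborel. (count_near x \<alpha> N S y)\<^sup>2) =
      (\<integral>y. (\<Sum>n=1..N. \<Sum>m=1..N. ?w n y * ?w m y) + 2 * (real N * S) * (\<Sum>n=1..N. ?w n y) +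
        (real N * S)\<^sup>2 \<partial>unit_measure)"
    unfolding integral_unit_measure[symmetric] count_near_eq[OF assms(1)]
    by (intro Bochner_Integration.integral_cong refl)
      (simp add: power2_sum sum_product power2_eq_square[of "sum _ _"])
  also have "\<dots> = (\<integral>y. (\<Sum>n=1..N. \<Sum>m=1..N. ?w n y * ?w m y) \<partial>unit_measure) +
      (\<integral>y. 2 * (real N * S) * (\<Sum>n=1..N. ?w n y) \<partial>unit_measure) + (real N * S)\<^sup>2"
    using i3 i4
    by (subst Bochner_Integration.integral_add; (subst Bochner_Integration.integral_add)?)
      (auto intro!: Bochner_Integration.integrable_add simp: measure_unit_measure)
  also have "(\<integral>y. (\<Sum>n=1..N. \<Sum>m=1..N. ?w n y * ?w m y) \<partial>unit_measure) =
      (\<Sum>n=1..N. \<Sum>m=1..N. \<integral>y. ?w n y * ?w m y \<partial>unit_measure)"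
    by (subst Bochner_Integration.integral_sum)
      (auto intro!: Bochner_Integration.integrable_sum i2 sum.cong Bochner_Integration.integral_sum)
  also have "(\<integral>y. 2 * (real N * S) * (\<Sum>n=1..N. ?w n y) \<partial>unit_measure) = 0"
    by (simp add: Bochner_Integration.integral_sum[OF i1] w0)
  finally show ?thesis by (simp add: number_variance_def power_mult_distrib)
qed

lemma set_integral_window_0:
  assumes "0 \<le> S" "S < 1"
  shows "(LINT s:{0..S}|lborel. window s 0) = S - S\<^sup>2"
proof -
  have "(LINT s:{0..S}|lborel. window s 0) = (\<integral>s. (1 - 2 * s) * indicator {0..S} s \<partial>lborel)"
    unfolding set_lebesgue_integral_def
  proof (rule integral_cong_AE)
    show "AE s in lborel. indicator {0..S} s *\<^sub>R window s 0 = (1 - 2 * s) * indicator {0..S} s"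
      using AE_lborel_singleton[of 0]
    proof eventually_elim
      fix s :: real assume "s \<noteq> 0"
      show "indicator {0..S} s *\<^sub>R window s 0 = (1 - 2 * s) * indicator {0..S} s"
      proof (cases "s \<in> {0..S}")
        case True
        then have s: "0 < s" "s < 1" using \<open>s \<noteq> 0\<close> assms by auto
        then have "\<lfloor>s\<rfloor> = 0" "\<lfloor>- s\<rfloor> = - 1" by linarith+
        then show ?thesis using True by (simp add: window_def)
      qed simp
    qed
  qed auto
  also have "\<dots> = (S - S\<^sup>2) - (0 - 0\<^sup>2)"
    by (rule integral_FTC_Icc_real) (use assms in \<open>auto intro!: derivative_eq_intros continuous_intros\<close>)
  finally show ?thesis by simp
qed

definition coincident_pairs :: "int poly \<Rightarrow> nat \<Rightarrow> (nat \<times> nat) set" where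
  "coincident_pairs p M = {(m, n). 1 \<le> m \<and> m < n \<and> n < M \<and> poly p (int m) = poly p (int n)}"

lemma finite_coincident_pairs: "finite (coincident_pairs p M)"
  by (rule finite_subset[of _ "{..<M} \<times> {..<M}"]) (auto simp: coincident_pairs_def)

text \<open>Ordered pairs split into the diagonal and two halves that agree by symmetry. A pair with
  equal values contributes as much as a diagonal one, namely \<open>S - S\<^sup>2\<close>.\<close>

lemma number_variance_decomp:
  assumes "0 \<le> S" "S < 1" "\<And>n. n \<ge> 1 \<Longrightarrow> x n = poly p (int n)"
  shows "number_variance x N S \<alpha> =
    (real N + 2 * real (card (coincident_pairs p (Suc N)))) * (S - S\<^sup>2) +
    2 * (LINT s:{0..S}|lborel. (\<Sum>\<pi>\<in>diff_pairs p (Suc N). window s (\<alpha> * real_of_int (pair_diff p \<pi>))))"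
proof -
  define I where "I n m = (\<integral>y. window (S / 2) (\<alpha> * real_of_int (x n) - y) *
      window (S / 2) (\<alpha> * real_of_int (x m) - y) \<partial>unit_measure)" for n m
  have I_eq: "I n m = (LINT s:{0..S}|lborel. window s (\<alpha> * real_of_int (x n - x m)))" for n m
    unfolding I_def window_autocorrelation[OF assms(1,2)] by (simp add: right_diff_distrib)
  have I_sym: "I n m = I m n" for n m
    unfolding I_def by (intro Bochner_Integration.integral_cong refl mult.commute)
  have I0: "I n m = S - S\<^sup>2" if "x n = x m" for n m
    using that set_integral_window_0[OF assms(1,2)] by (simp add: I_eq)
  let ?J = "{1..N}"
  let ?L = "{(m, n). m \<in> ?J \<and> n \<in> ?J \<and> m < n}" and ?G = "{(m, n). m \<in> ?J \<and> n \<in> ?J \<and> n < m}"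
  let ?D = "diff_pairs p (Suc N)" and ?C = "coincident_pairs p (Suc N)"
  have finL: "finite ?L" "finite ?G" by (rule finite_subset[of _ "?J \<times> ?J"]; auto)+
  have "number_variance x N S \<alpha> = (\<Sum>(m, n)\<in>?J \<times> ?J. I n m)"
    unfolding number_variance_eq[OF assms(1,2)] sum.cartesian_product[symmetric] I_def[symmetric]
    by (simp add: I_sym)
  also have "?J \<times> ?J = (\<lambda>n. (n, n)) ` ?J \<union> (?L \<union> ?G)" by auto
  also have "(\<Sum>(m, n)\<in>(\<lambda>n. (n, n)) ` ?J \<union> (?L \<union> ?G). I n m) =
      (\<Sum>(m, n)\<in>(\<lambda>n. (n, n)) ` ?J. I n m) + ((\<Sum>(m, n)\<in>?L. I n m) + (\<Sum>(m, n)\<in>?G. I n m))"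
    using finL by (subst sum.union_disjoint; (subst sum.union_disjoint)?) auto
  also have "(\<Sum>(m, n)\<in>(\<lambda>n. (n, n)) ` ?J. I n m) = real N * (S - S\<^sup>2)"
    by (subst sum.reindex) (auto simp: inj_on_def I0)
  also have "(\<Sum>(m, n)\<in>?G. I n m) = (\<Sum>(m, n)\<in>?L. I n m)"
    by (rule sum.reindex_bij_witness[of _ "\<lambda>(m, n). (n, m)" "\<lambda>(m, n). (n, m)"]) (auto simp: I_sym)
  also have "?L = ?C \<union> ?D" by (auto simp: coincident_pairs_def diff_pairs_def)
  also have "(\<Sum>(m, n)\<in>?C \<union> ?D. I n m) = (\<Sum>(m, n)\<in>?C. I n m) + (\<Sum>(m, n)\<in>?D. I n m)"
    by (intro sum.union_disjoint finite_coincident_pairs finite_diff_pairs)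
      (auto simp: coincident_pairs_def diff_pairs_def)
  also have "(\<Sum>(m, n)\<in>?C. I n m) = real (card ?C) * (S - S\<^sup>2)"
  proof -
    have "(\<Sum>(m, n)\<in>?C. I n m) = (\<Sum>\<pi>\<in>?C. S - S\<^sup>2)"
      by (intro sum.cong refl) (auto simp: coincident_pairs_def assms(3) intro!: I0)
    then show ?thesis by simp
  qed
  also have "(\<Sum>(m, n)\<in>?D. I n m) =
      (\<Sum>\<pi>\<in>?D. LINT s:{0..S}|lborel. window s (\<alpha> * real_of_int (pair_diff p \<pi>)))"
    by (intro sum.cong refl) (auto simp: diff_pairs_def pair_diff_def assms(3) I_eq)
  also have "\<dots> = (LINT s:{0..S}|lborel. (\<Sum>\<pi>\<in>?D. window s (\<alpha> * real_of_int (pair_diff p \<pi>))))"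
    unfolding set_lebesgue_integral_def scaleR_sum_right
  proof (rule Bochner_Integration.integral_sum[symmetric])
    fix \<pi>
    show "integrable lborel (\<lambda>s. indicator {0..S} s *\<^sub>R window s (\<alpha> * real_of_int (pair_diff p \<pi>)))"
      using set_integrable_bounded[OF borel_measurable_window_fst abs_window_le_1]
      unfolding set_integrable_def .
  qed
  finally show ?thesis by (simp add: algebra_simps)
qed

section \<open>A maximal inequality\<close>

lemma poly_int_eventually_pos:
  fixes q :: "int poly"
  assumes "lead_coeff q > 0"
  shows "\<exists>n0. \<forall>x\<ge>n0. poly q x > 0"
  using assms
proof (induction q)
  case (pCons a q)
  show ?case
  proof (cases "q = 0")
    case True
    then show ?thesis using pCons.prems by auto
  next
    case False
    then obtain n0 where n0: "\<And>x. x \<ge> n0 \<Longrightarrow> poly q x > 0" using pCons by auto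
    have "poly (pCons a q) x > 0" if "x \<ge> max n0 (\<bar>a\<bar> + 1)" for x
    proof -
      have "x * 1 \<le> x * poly q x" using n0[of x] that by (intro mult_left_mono) auto
      moreover have "a + x > 0" using that by auto
      ultimately show ?thesis by simp
    qed
    then show ?thesis by blast
  qed
qed simp

text \<open>The first difference of \<open>p\<close> is a nonzero polynomial and has constant sign
  from some point on, so \<open>p\<close> is strictly monotone there.\<close>

lemma inj_on_poly_eventually:
  fixes p :: "int poly"
  assumes "degree p \<ge> 2"
  shows "\<exists>n0. inj_on (\<lambda>n. poly p (int n)) {n0..}"
proof -
  define q where "q = pcompose p [:1, 1:] - p"
  have poly_q: "poly q x = poly p (x + 1) - poly p x" for x
    by (simp add: q_def poly_pcompose add.commute)
  have "q \<noteq> 0"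
  proof
    assume "q = 0"
    then have "{x. poly p (x + 1) - poly p x = 0} = UNIV" using poly_q by auto
    then show False using card_shift_difference_le(1)[OF assms, of 1 0] infinite_UNIV_int by simp
  qed
  have mono: "inj_on f {n0..}" if "\<And>n. n \<ge> n0 \<Longrightarrow> f n < f (Suc n)" for n0 :: nat and f :: "nat \<Rightarrow> int"
  proof -
    have "f m < f n" if "m < n" "m \<ge> n0" for m n
      using that
    proof (induction n rule: less_induct)
      case (less n)
      then obtain k where k: "n = Suc k" by (cases n) auto
      show ?case
      proof (cases "m = k")
        case False
        then have "f m < f k" using less k by (intro less.IH) auto
        also have "f k < f n" using \<open>\<And>n. n \<ge> n0 \<Longrightarrow> f n < f (Suc n)\<close>[of k] less.prems k by simp
        finally show ?thesis .
      qed (use \<open>\<And>n. n \<ge> n0 \<Longrightarrow> f n < f (Suc n)\<close>[of k] less.prems k in simp)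
    qed
    then show ?thesis by (auto simp: inj_on_def) (metis less_irrefl linorder_neqE_nat)
  qed
  show ?thesis
  proof (cases "lead_coeff q > 0")
    case True
    then obtain n0 where n0: "\<And>x. x \<ge> n0 \<Longrightarrow> poly q x > 0" using poly_int_eventually_pos by blast
    have "inj_on (\<lambda>n. poly p (int n)) {nat n0..}"
    proof (rule mono)
      fix n assume "n \<ge> nat n0"
      then show "poly p (int n) < poly p (int (Suc n))"
        using n0[of "int n"] poly_q[of "int n"] by (simp add: add.commute)
    qed
    then show ?thesis by blast
  next
    case False
    have "lead_coeff q \<noteq> 0" using \<open>q \<noteq> 0\<close> by simp
    then have "lead_coeff q < 0" using False by linarith
    then have "lead_coeff (- q) > 0" by simp
    then obtain n0 where n0: "\<And>x. x \<ge> n0 \<Longrightarrow> poly (- q) x > 0"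
      using poly_int_eventually_pos by blast
    have "inj_on (\<lambda>n. - poly p (int n)) {nat n0..}"
    proof (rule mono)
      fix n assume "n \<ge> nat n0"
      then show "- poly p (int n) < - poly p (int (Suc n))"
        using n0[of "int n"] poly_q[of "int n"] by (simp add: add.commute)
    qed
    then show ?thesis by (auto simp: inj_on_def)
  qed
qed

text \<open>Past \<open>n0\<close> the values are distinct, so the smaller index of a coincident
  pair is below \<open>n0\<close>, and each value is taken only finitely often.\<close>

lemma card_coincident_pairs_bounded:
  fixes p :: "int poly"
  assumes "degree p \<ge> 2"
  shows "\<exists>Z. \<forall>M. card (coincident_pairs p M) \<le> Z"
proof -
  obtain n0 where n0: "inj_on (\<lambda>n. poly p (int n)) {n0..}"
    using inj_on_poly_eventually[OF assms] by blast
  let ?R = "\<lambda>m. {n. poly p (int n) = poly p (int m)}"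
  have fin: "finite (?R m)" for m
  proof -
    have "degree (p + [:- poly p (int m):]) = degree p"
      using assms degree_add_eq_left[of "[:- poly p (int m):]" p] by simp
    then have "degree (p - [:poly p (int m):]) = degree p" by (simp add: diff_conv_add_uminus del: add_uminus_conv_diff)
    then have "p - [:poly p (int m):] \<noteq> 0" using assms by (metis degree_0 not_numeral_le_zero)
    then have "finite {x. poly (p - [:poly p (int m):]) x = 0}" by (rule poly_roots_finite)
    moreover have "int ` ?R m \<subseteq> {x. poly (p - [:poly p (int m):]) x = 0}" by auto
    ultimately have "finite (int ` ?R m)" by (rule rev_finite_subset)
    then show ?thesis by (rule finite_imageD) simp
  qed
  let ?U = "SIGMA m:{..<n0}. ?R m"
  have finU: "finite ?U" using fin by (intro finite_SigmaI) auto
  have "coincident_pairs p M \<subseteq> ?U" for M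
  proof (rule subrelI)
    fix m n assume "(m, n) \<in> coincident_pairs p M"
    then have mn: "m < n" "poly p (int m) = poly p (int n)" by (auto simp: coincident_pairs_def)
    have "m < n0"
    proof (rule ccontr)
      assume "\<not> m < n0"
      then have "m = n" using inj_onD[OF n0 mn(2)] mn(1) by simp
      then show False using mn(1) by simp
    qed
    then show "(m, n) \<in> ?U" using mn(2) by simp
  qed
  then have "card (coincident_pairs p M) \<le> card ?U" for M by (intro card_mono finU)
  then show ?thesis by blast
qed

section \<open>Dyadic blocks and the maximal quadratic form\<close>

text \<open>One plus the number of \<open>l < k\<close> for which \<open>i\<close> and \<open>j\<close> lie in the same dyadic block of
  length \<open>2 ^ l\<close>.\<close>

fun block_weight :: "nat \<Rightarrow> nat \<Rightarrow> nat \<Rightarrow> real" where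
  "block_weight 0 i j = 1"
| "block_weight (Suc k) i j = (if i = j then 1 else 0) + block_weight k (i div 2) (j div 2)"

lemma block_weight_bounds: "0 \<le> block_weight k i j \<and> block_weight k i j \<le> real k + 1"
proof (induction k arbitrary: i j)
  case (Suc k)
  have "0 \<le> block_weight k (i div 2) (j div 2)" "block_weight k (i div 2) (j div 2) \<le> real k + 1"
    using Suc by auto
  then show ?case by (cases "i = j") auto
qed simp

lemma sum_lessThan_double:
  fixes f :: "nat \<Rightarrow> real"
  shows "(\<Sum>i<2 * n. f i) = (\<Sum>i<n. f (2 * i) + f (2 * i + 1))"
  by (induction n) (auto simp: add_ac)

text \<open>The Rademacher--Menshov inequality: an initial segment of \<open>{..<2 ^ k}\<close> is the union of at
  most one dyadic block of each length.\<close>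

lemma rademacher_menshov:
  fixes y :: "nat \<Rightarrow> real"
  assumes "N \<le> 2 ^ k"
  shows "(\<Sum>i<N. y i)\<^sup>2 \<le> (real k + 1) * (\<Sum>i<2 ^ k. \<Sum>j<2 ^ k. block_weight k i j * (y i * y j))"
  using assms
proof (induction k arbitrary: N y)
  case 0
  then have "N = 0 \<or> N = 1" by auto
  then show ?case by (auto simp: power2_eq_square)
next
  case (Suc k)
  let ?n = "2 ^ k :: nat"
  \<comment> \<open>Consecutive entries are merged: the form in \<open>z\<close> at level
    \<open>k\<close> covers the blocks of length at least 2, and \<open>Y\<close> the blocks of
    length 1. Below, \<open>a\<close> sums the complete pairs and \<open>b\<close> is the unpaired
    last entry of an odd segment.\<close>
  define z where "z i = y (2 * i) + y (2 * i + 1)" for i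
  define X where "X = (\<Sum>i<?n. \<Sum>j<?n. block_weight k i j * (z i * z j))"
  define Y where "Y = (\<Sum>i<2 * ?n. (y i)\<^sup>2)"
  define a where "a = (\<Sum>i<N div 2. z i)"
  define b where "b = (if odd N then y (N - 1) else 0)"
  have dec: "(\<Sum>i<2 ^ Suc k. \<Sum>j<2 ^ Suc k. block_weight (Suc k) i j * (y i * y j)) = Y + X"
  proof -
    have "(\<Sum>i<2 * ?n. \<Sum>j<2 * ?n. block_weight (Suc k) i j * (y i * y j)) =
        (\<Sum>i<2 * ?n. \<Sum>j<2 * ?n. (if i = j then y i * y j else 0)) +
        (\<Sum>i<2 * ?n. \<Sum>j<2 * ?n. block_weight k (i div 2) (j div 2) * (y i * y j))"
      unfolding sum.distrib[symmetric] by (intro sum.cong refl) (auto simp: algebra_simps)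
    also have "(\<Sum>i<2 * ?n. \<Sum>j<2 * ?n. (if i = j then y i * y j else 0)) = Y"
      unfolding Y_def by (intro sum.cong refl) (simp add: power2_eq_square)
    also have "(\<Sum>i<2 * ?n. \<Sum>j<2 * ?n. block_weight k (i div 2) (j div 2) * (y i * y j)) = X"
      unfolding sum_lessThan_double X_def z_def sum.distrib[symmetric]
      by (intro sum.cong refl) (simp add: algebra_simps)
    finally show ?thesis by simp
  qed
  have N2: "N div 2 \<le> ?n" using Suc.prems by simp
  have split: "(\<Sum>i<N. y i) = a + b"
  proof (cases "odd N")
    case True
    then have "N = Suc (2 * (N div 2))" by simp
    then have "(\<Sum>i<N. y i) = (\<Sum>i<2 * (N div 2). y i) + y (2 * (N div 2))"
      by (metis sum.lessThan_Suc)
    moreover have "b = y (2 * (N div 2))" using True by (simp add: b_def)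
    ultimately show ?thesis unfolding sum_lessThan_double a_def z_def by simp
  next
    case False
    then have "N = 2 * (N div 2)" by simp
    then have "(\<Sum>i<N. y i) = (\<Sum>i<2 * (N div 2). y i)" by simp
    then show ?thesis using False unfolding sum_lessThan_double a_def b_def z_def by simp
  qed
  have aX: "a\<^sup>2 \<le> (real k + 1) * X" unfolding a_def X_def by (rule Suc.IH[OF N2])
  have bY: "b\<^sup>2 \<le> Y"
  proof (cases "odd N")
    case True
    then have "N - 1 < 2 * ?n" using Suc.prems by (cases N) auto
    then have "(y (N - 1))\<^sup>2 \<le> Y" unfolding Y_def
      by (intro member_le_sum[of "N - 1" _ "\<lambda>i. (y i)\<^sup>2"]) auto
    then show ?thesis using True by (simp add: b_def)
  qed (auto simp: b_def Y_def intro!: sum_nonneg)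
  have k1: "real k + 1 > 0" by simp
  \<comment> \<open>The weight \<open>real k + 1\<close> is chosen so that both coefficients become
    \<open>real k + 2\<close> once the bounds for \<open>a\<close> and \<open>b\<close> are
    inserted.\<close>
  have "(a + b)\<^sup>2 \<le> (1 + 1 / (real k + 1)) * a\<^sup>2 + (1 + (real k + 1)) * b\<^sup>2"
  proof -
    have "0 \<le> (a - (real k + 1) * b)\<^sup>2 / (real k + 1)" using k1 by simp
    also have "\<dots> = a\<^sup>2 / (real k + 1) - 2 * a * b + (real k + 1) * b\<^sup>2"
      using k1 by (simp add: power2_diff power_mult_distrib field_simps power2_eq_square)
    finally show ?thesis by (simp add: power2_sum algebra_simps)
  qed
  also have "(1 + 1 / (real k + 1)) * a\<^sup>2 \<le> (1 + 1 / (real k + 1)) * ((real k + 1) * X)"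
    by (intro mult_left_mono aX) simp
  also have "\<dots> = (real k + 2) * X" using k1 by (simp add: field_simps)
  also have "(1 + (real k + 1)) * b\<^sup>2 \<le> (1 + (real k + 1)) * Y"
    by (intro mult_left_mono bY) simp
  finally show ?case unfolding split dec by (simp add: algebra_simps)
qed

text \<open>The Rademacher--Menshov majorant with pairs grouped by their larger index, which is why
  the weight looks at \<open>snd\<close>. It does not depend on \<open>N\<close>.\<close>

definition max_form :: "int poly \<Rightarrow> nat \<Rightarrow> real \<Rightarrow> real \<Rightarrow> real" where
  "max_form p k s \<alpha> = (real k + 1) * (\<Sum>\<pi>\<in>diff_pairs p (2 ^ k). \<Sum>\<sigma>\<in>diff_pairs p (2 ^ k).
    block_weight k (snd \<pi>) (snd \<sigma>) *
      (window s (\<alpha> * real_of_int (pair_diff p \<pi>)) * window s (\<alpha> * real_of_int (pair_diff p \<sigma>))))"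

text \<open>Passing from \<open>N - 1\<close> to \<open>N\<close> adds exactly the pairs with larger
  index \<open>N\<close>; the sum is therefore a partial sum of the group totals
  \<open>y\<close>.\<close>

lemma sum_diff_pairs_sq_le:
  assumes "N < 2 ^ k"
  shows "(\<Sum>\<pi>\<in>diff_pairs p (Suc N). window s (\<alpha> * real_of_int (pair_diff p \<pi>)))\<^sup>2 \<le> max_form p k s \<alpha>"
proof -
  let ?P = "diff_pairs p (2 ^ k)"
  let ?w = "\<lambda>\<pi>. window s (\<alpha> * real_of_int (pair_diff p \<pi>))"
  define y where "y i = (\<Sum>\<pi> | \<pi> \<in> ?P \<and> snd \<pi> = i. ?w \<pi>)" for i
  have sub: "diff_pairs p (Suc N) \<subseteq> ?P" using assms by (auto simp: diff_pairs_def)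
  have "(\<Sum>\<pi>\<in>diff_pairs p (Suc N). ?w \<pi>) =
      (\<Sum>i<Suc N. \<Sum>\<pi> | \<pi> \<in> diff_pairs p (Suc N) \<and> snd \<pi> = i. ?w \<pi>)"
    by (rule sum.group[OF finite_diff_pairs, symmetric]) (auto simp: diff_pairs_def)
  also have "\<dots> = (\<Sum>i<Suc N. y i)"
    unfolding y_def using assms by (intro sum.cong refl) (auto simp: diff_pairs_def)
  finally have "(\<Sum>\<pi>\<in>diff_pairs p (Suc N). ?w \<pi>)\<^sup>2 \<le>
      (real k + 1) * (\<Sum>i<2 ^ k. \<Sum>j<2 ^ k. block_weight k i j * (y i * y j))"
    using rademacher_menshov[of "Suc N" k y] assms by simp
  also have "(\<Sum>i<2 ^ k. \<Sum>j<2 ^ k. block_weight k i j * (y i * y j)) =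
      (\<Sum>\<pi>\<in>?P. \<Sum>\<sigma>\<in>?P. block_weight k (snd \<pi>) (snd \<sigma>) * (?w \<pi> * ?w \<sigma>))"
  proof -
    have grp: "(\<Sum>\<pi>\<in>?P. ?w \<pi> * f (snd \<pi>)) = (\<Sum>i<2 ^ k. y i * f i)" for f :: "nat \<Rightarrow> real"
    proof -
      have "(\<Sum>\<pi>\<in>?P. ?w \<pi> * f (snd \<pi>)) = (\<Sum>i<2 ^ k. \<Sum>\<pi> | \<pi> \<in> ?P \<and> snd \<pi> = i. ?w \<pi> * f (snd \<pi>))"
        by (rule sum.group[OF finite_diff_pairs, symmetric]) (auto simp: diff_pairs_def)
      also have "\<dots> = (\<Sum>i<2 ^ k. y i * f i)"
        unfolding y_def sum_distrib_right by (intro sum.cong refl) auto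
      finally show ?thesis .
    qed
    have "(\<Sum>\<pi>\<in>?P. \<Sum>\<sigma>\<in>?P. block_weight k (snd \<pi>) (snd \<sigma>) * (?w \<pi> * ?w \<sigma>)) =
        (\<Sum>\<pi>\<in>?P. ?w \<pi> * (\<Sum>\<sigma>\<in>?P. ?w \<sigma> * block_weight k (snd \<pi>) (snd \<sigma>)))"
      by (simp add: sum_distrib_left mult_ac)
    also have "\<dots> = (\<Sum>i<2 ^ k. y i * (\<Sum>j<2 ^ k. y j * block_weight k i j))"
      unfolding grp by (rule grp)
    finally show ?thesis by (simp add: sum_distrib_left mult_ac)
  qed
  finally show ?thesis by (simp add: max_form_def)
qed

lemma max_form_nonneg: "0 \<le> max_form p k s \<alpha>"
  by (rule order_trans[OF zero_le_power2 sum_diff_pairs_sq_le[of 0]]) simp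

section \<open>Mean values of the maximal form and its energy\<close>

definition gcd_sum :: "int poly \<Rightarrow> nat \<Rightarrow> real" where
  "gcd_sum p M = (\<Sum>\<pi>\<in>diff_pairs p M. \<Sum>\<sigma>\<in>diff_pairs p M.
      real (gcd (nat \<bar>pair_diff p \<pi>\<bar>) (nat \<bar>pair_diff p \<sigma>\<bar>)) /
      real (max (nat \<bar>pair_diff p \<pi>\<bar>) (nat \<bar>pair_diff p \<sigma>\<bar>)))"

lemma borel_measurable_window_scale [measurable]: "(\<lambda>\<alpha>. window s (\<alpha> * c)) \<in> borel_measurable borel"
  unfolding window_def by measurable

lemma integrable_window_mult:
  "integrable unit_measure (\<lambda>\<alpha>. window s (\<alpha> * c) * window s (\<alpha> * d))"
  by (rule integrable_unit_measure[OF _ abs_window_mult_le_1]) measurable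

lemma integrable_max_form: "integrable unit_measure (max_form p k s)"
  unfolding max_form_def
  by (intro integrable_mult_right Bochner_Integration.integrable_sum integrable_window_mult)

text \<open>The weights lie between 0 and \<open>real k + 1\<close>, so each correlation may be
  replaced by its bound; the square combines this factor with the one in front of the form.\<close>

lemma integral_max_form_le:
  assumes "s \<ge> 0"
  shows "(\<integral>\<alpha>. max_form p k s \<alpha> \<partial>unit_measure) \<le> 4 * (real k + 1)\<^sup>2 * gcd_sum p (2 ^ k) * s"
proof -
  let ?P = "diff_pairs p (2 ^ k)" and ?v = "\<lambda>\<pi>. real_of_int (pair_diff p \<pi>)"
  let ?r = "\<lambda>\<pi> \<sigma>. real (gcd (nat \<bar>pair_diff p \<pi>\<bar>) (nat \<bar>pair_diff p \<sigma>\<bar>)) /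
      real (max (nat \<bar>pair_diff p \<pi>\<bar>) (nat \<bar>pair_diff p \<sigma>\<bar>))"
  have "(\<integral>\<alpha>. max_form p k s \<alpha> \<partial>unit_measure) = (real k + 1) * (\<Sum>\<pi>\<in>?P. \<Sum>\<sigma>\<in>?P.
      block_weight k (snd \<pi>) (snd \<sigma>) * (\<integral>\<alpha>. window s (\<alpha> * ?v \<pi>) * window s (\<alpha> * ?v \<sigma>) \<partial>unit_measure))"
    unfolding max_form_def
    by (simp add: Bochner_Integration.integral_sum Bochner_Integration.integrable_sum integrable_window_mult)
  also have "\<dots> \<le> (real k + 1) * (\<Sum>\<pi>\<in>?P. \<Sum>\<sigma>\<in>?P. (real k + 1) * (4 * s * ?r \<pi> \<sigma>))"
  proof (intro mult_left_mono sum_mono)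
    fix \<pi> \<sigma> assume "\<pi> \<in> ?P" "\<sigma> \<in> ?P"
    then have "\<bar>\<integral>\<alpha>. window s (\<alpha> * ?v \<pi>) * window s (\<alpha> * ?v \<sigma>) \<partial>unit_measure\<bar> \<le> 4 * s * ?r \<pi> \<sigma>"
      using assms by (intro window_correlation_le) (auto dest: pair_diff_nonzero)
    then have "(\<integral>\<alpha>. window s (\<alpha> * ?v \<pi>) * window s (\<alpha> * ?v \<sigma>) \<partial>unit_measure) \<le> 4 * s * ?r \<pi> \<sigma>" by linarith
    then have "block_weight k (snd \<pi>) (snd \<sigma>) * (\<integral>\<alpha>. window s (\<alpha> * ?v \<pi>) * window s (\<alpha> * ?v \<sigma>) \<partial>unit_measure)
        \<le> block_weight k (snd \<pi>) (snd \<sigma>) * (4 * s * ?r \<pi> \<sigma>)"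
      using block_weight_bounds by (intro mult_left_mono) auto
    also have "\<dots> \<le> (real k + 1) * (4 * s * ?r \<pi> \<sigma>)"
      using block_weight_bounds assms by (intro mult_right_mono) auto
    finally show "block_weight k (snd \<pi>) (snd \<sigma>) * (\<integral>\<alpha>. window s (\<alpha> * ?v \<pi>) * window s (\<alpha> * ?v \<sigma>) \<partial>unit_measure)
        \<le> (real k + 1) * (4 * s * ?r \<pi> \<sigma>)" .
  qed simp
  also have "\<dots> = 4 * (real k + 1)\<^sup>2 * gcd_sum p (2 ^ k) * s"
    unfolding gcd_sum_def by (simp only: sum_distrib_left sum_distrib_right power2_eq_square mult_ac)
  finally show ?thesis .
qed

lemma borel_measurable_max_form [measurable]:
  "(\<lambda>x. max_form p k (fst x) (snd x)) \<in> borel_measurable (borel \<Otimes>\<^sub>M borel)"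
  unfolding max_form_def window_def by measurable

lemma borel_measurable_max_form_fst [measurable]: "(\<lambda>s. max_form p k s \<alpha>) \<in> borel_measurable borel"
  unfolding max_form_def by measurable

text \<open>The division by \<open>s\<close> matches the linear growth of the mean in
  \<open>s\<close> and later gives one bound for all \<open>S \<le> T\<close>. Values in
  \<open>ennreal\<close> avoid any integrability question near \<open>s = 0\<close>.\<close>

definition max_energy :: "int poly \<Rightarrow> nat \<Rightarrow> real \<Rightarrow> real \<Rightarrow> ennreal" where
  "max_energy p k T \<alpha> = (\<integral>\<^sup>+ s. ennreal (max_form p k s \<alpha> / s) * indicator {0<..T} s \<partial>lborel)"

lemma borel_measurable_max_energy: "max_energy p k T \<in> borel_measurable unit_measure"
proof -
  have "(\<lambda>\<alpha>. \<integral>\<^sup>+ s. ennreal (max_form p k s \<alpha> / s) * indicator {0<..T} s \<partial>lborel) \<in> borel_measurable borel"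
  proof (rule lborel.borel_measurable_nn_integral)
    have "(\<lambda>x. max_form p k (snd x) (fst x)) \<in> borel_measurable (borel \<Otimes>\<^sub>M borel)"
      unfolding max_form_def window_def by measurable
    then show "(\<lambda>(\<alpha>, s). ennreal (max_form p k s \<alpha> / s) * indicator {0<..T} s)
        \<in> borel_measurable (borel \<Otimes>\<^sub>M lborel)"
      by (simp add: case_prod_beta')
  qed
  then show ?thesis
    unfolding unit_measure_def max_energy_def by (intro measurable_restrict_space1) simp
qed

text \<open>By Tonelli the mean over \<alpha> is taken first; after division by \<open>s\<close> it
  is at most a constant \<open>B\<close>, so integrating over \<open>{0<..T}\<close> gives
  \<open>B * T\<close>.\<close>

lemma nn_integral_max_energy_le:
  assumes "T \<ge> 0"
  shows "(\<integral>\<^sup>+ \<alpha>. max_energy p k T \<alpha> \<partial>unit_measure) \<le> ennreal (4 * (real k + 1)\<^sup>2 * gcd_sum p (2 ^ k) * T)"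
proof -
  define B where "B = 4 * (real k + 1)\<^sup>2 * gcd_sum p (2 ^ k)"
  have B0: "B \<ge> 0" unfolding B_def gcd_sum_def by (intro mult_nonneg_nonneg sum_nonneg) auto
  let ?h = "\<lambda>s \<alpha>. ennreal (max_form p k s \<alpha> / s) * indicator {0<..T} s"
  have "(\<integral>\<^sup>+ \<alpha>. max_energy p k T \<alpha> \<partial>unit_measure) =
      (\<integral>\<^sup>+ \<alpha>. (\<integral>\<^sup>+ s. ?h s \<alpha> \<partial>lborel) * indicator {0..1} \<alpha> \<partial>lborel)"
    unfolding unit_measure_def max_energy_def by (rule nn_integral_restrict_space) simp
  also have "\<dots> = (\<integral>\<^sup>+ \<alpha>. (\<integral>\<^sup>+ s. ?h s \<alpha> * indicator {0..1} \<alpha> \<partial>lborel) \<partial>lborel)"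
    by (intro nn_integral_cong nn_integral_multc[symmetric]) measurable
  also have "\<dots> = (\<integral>\<^sup>+ s. (\<integral>\<^sup>+ \<alpha>. ?h s \<alpha> * indicator {0..1} \<alpha> \<partial>lborel) \<partial>lborel)"
    by (rule lborel_pair.Fubini') (simp add: case_prod_beta')
  also have "\<dots> = (\<integral>\<^sup>+ s. (\<integral>\<^sup>+ \<alpha>. ?h s \<alpha> \<partial>unit_measure) \<partial>lborel)"
    unfolding unit_measure_def by (intro nn_integral_cong nn_integral_restrict_space[symmetric]) simp
  also have "\<dots> \<le> (\<integral>\<^sup>+ s. ennreal B * indicator {0<..T} s \<partial>lborel)"
  proof (intro nn_integral_mono)
    fix s :: real
    show "(\<integral>\<^sup>+ \<alpha>. ?h s \<alpha> \<partial>unit_measure) \<le> ennreal B * indicator {0<..T} s"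
    proof (cases "s \<in> {0<..T}")
      case True
      then have s: "s > 0" by simp
      have "(\<integral>\<^sup>+ \<alpha>. ennreal (max_form p k s \<alpha> / s) \<partial>unit_measure) =
          ennreal (\<integral>\<alpha>. max_form p k s \<alpha> / s \<partial>unit_measure)"
        using s by (intro nn_integral_eq_integral) (auto intro!: integrable_max_form simp: max_form_nonneg)
      also have "\<dots> \<le> ennreal B"
        using integral_max_form_le[of s p k] s by (intro ennreal_leI) (simp add: field_simps B_def)
      finally show ?thesis using True by simp
    qed simp
  qed
  also have "\<dots> = ennreal B * ennreal T"
    using assms by (subst nn_integral_cmult_indicator) auto
  finally show ?thesis using B0 assms by (simp add: B_def ennreal_mult)
qed

section \<open>Almost everywhere convergence\<close>

text \<open>The normalised energies have summable means, so their sum is finite almost everywhere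
  and its terms tend to zero. The null set does not depend on \<eta>.\<close>

lemma max_energy_small:
  fixes p :: "int poly"
  assumes "degree p \<ge> 2"
  shows "\<exists>c::nat>0. AE \<alpha> in unit_measure. \<forall>\<eta>>0. \<forall>\<^sub>F k in sequentially.
    max_energy p k ((4 / real k) ^ c) \<alpha> \<le> ennreal (\<eta> * 4 ^ k)"
proof -
  obtain C E where C: "C \<ge> 0" and CE: "\<And>M. M \<ge> 2 \<Longrightarrow> gcd_sum p M \<le> C * real M ^ 2 * (1 + ln (real M)) ^ E"
    using gcd_sum_diff_pairs_le[OF assms] unfolding gcd_sum_def by blast
  \<comment> \<open>The mean of the normalised energy is of order k^(E + 2) times the range
    \<open>T k\<close>; the exponent \<open>E + 4\<close> leaves a summable multiple of 1 /
    k^2.\<close>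
  define c where "c = E + 4"
  define T where "T k = (4 / real k) ^ c" for k
  define K where "K = 4 * C * 2 ^ (E + 2) * 4 ^ c"
  define f where "f k \<alpha> = ennreal (1 / 4 ^ k) * max_energy p k (T k) \<alpha>" for k \<alpha>
  have f_meas: "f k \<in> borel_measurable unit_measure" for k
    unfolding f_def using borel_measurable_max_energy by measurable
  have f_int: "(\<integral>\<^sup>+ \<alpha>. f k \<alpha> \<partial>unit_measure) \<le> ennreal (K / (real k)\<^sup>2)" if k: "k \<ge> 1" for k
  proof -
    have "gcd_sum p (2 ^ k) \<le> C * (2 ^ k)\<^sup>2 * (1 + ln (2 ^ k)) ^ E"
      using CE[of "2 ^ k"] k self_le_power[of "2 :: nat" k] by simp
    also have "\<dots> \<le> C * (2 ^ k)\<^sup>2 * (1 + real k) ^ E"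
    proof (intro mult_left_mono power_mono)
      have "ln (2 ^ k) = real k * ln 2" by (simp add: ln_realpow)
      also have "\<dots> \<le> real k * 1" by (intro mult_left_mono) (auto simp: ln_2_less_1 less_imp_le)
      finally show "1 + ln (2 ^ k) \<le> 1 + real k" by simp
    qed (use C in auto)
    also have "(2 ^ k)\<^sup>2 = (4 :: real) ^ k" by (simp add: power2_eq_square power_mult_distrib[symmetric])
    finally have g: "gcd_sum p (2 ^ k) \<le> C * 4 ^ k * (1 + real k) ^ E" .
    have "1 / 4 ^ k * (4 * (real k + 1)\<^sup>2 * gcd_sum p (2 ^ k) * T k)
        \<le> 1 / 4 ^ k * (4 * (real k + 1)\<^sup>2 * (C * 4 ^ k * (1 + real k) ^ E) * T k)"
      by (intro mult_left_mono mult_right_mono g) (auto simp: T_def)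
    also have "\<dots> = 4 * C * (1 + real k) ^ (E + 2) * T k"
      by (simp add: power_add power2_eq_square field_simps)
    also have "\<dots> \<le> 4 * C * (2 * real k) ^ (E + 2) * T k"
      using k C by (intro mult_left_mono mult_right_mono power_mono) (auto simp: T_def)
    also have "\<dots> = K / (real k)\<^sup>2"
      using k by (simp add: T_def K_def c_def power_mult_distrib power_divide power_add field_simps power2_eq_square numeral_eq_Suc)
    finally have le: "1 / 4 ^ k * (4 * (real k + 1)\<^sup>2 * gcd_sum p (2 ^ k) * T k) \<le> K / (real k)\<^sup>2" .
    have "(\<integral>\<^sup>+ \<alpha>. f k \<alpha> \<partial>unit_measure) = ennreal (1 / 4 ^ k) * (\<integral>\<^sup>+ \<alpha>. max_energy p k (T k) \<alpha> \<partial>unit_measure)"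
      unfolding f_def by (rule nn_integral_cmult[OF borel_measurable_max_energy])
    also have "\<dots> \<le> ennreal (1 / 4 ^ k) * ennreal (4 * (real k + 1)\<^sup>2 * gcd_sum p (2 ^ k) * T k)"
      by (intro mult_left_mono nn_integral_max_energy_le) (auto simp: T_def)
    also have "\<dots> = ennreal (1 / 4 ^ k * (4 * (real k + 1)\<^sup>2 * gcd_sum p (2 ^ k) * T k))"
      by (rule ennreal_mult'[symmetric]) simp
    also have "\<dots> \<le> ennreal (K / (real k)\<^sup>2)" by (rule ennreal_leI[OF le])
    finally show ?thesis .
  qed
  have K0: "K \<ge> 0" using C by (simp add: K_def)
  \<comment> \<open>Indices start at 1, where \<open>f_int\<close> applies.\<close>
  have summ: "summable (\<lambda>k. K / (real (Suc k))\<^sup>2)"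
  proof -
    have "summable (\<lambda>k. inverse ((real k)\<^sup>2))" using inverse_power_summable[of 2, where 'a = real] by simp
    then have "summable (\<lambda>k. inverse ((real (Suc k))\<^sup>2))" by (subst summable_Suc_iff)
    then show ?thesis unfolding divide_inverse by (rule summable_mult)
  qed
  have "(\<integral>\<^sup>+ \<alpha>. (\<Sum>k. f (Suc k) \<alpha>) \<partial>unit_measure) = (\<Sum>k. \<integral>\<^sup>+ \<alpha>. f (Suc k) \<alpha> \<partial>unit_measure)"
    by (rule nn_integral_suminf[OF f_meas])
  also have "\<dots> \<le> (\<Sum>k. ennreal (K / (real (Suc k))\<^sup>2))"
    by (intro suminf_le f_int summableI) simp
  also have "\<dots> < top"
    unfolding less_top[symmetric] using K0 by (intro ennreal_suminf_neq_top[OF summ]) (intro divide_nonneg_nonneg zero_le_power2)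
  finally have "(\<integral>\<^sup>+ \<alpha>. (\<Sum>k. f (Suc k) \<alpha>) \<partial>unit_measure) \<noteq> \<infinity>" by simp
  then have "AE \<alpha> in unit_measure. (\<Sum>k. f (Suc k) \<alpha>) \<noteq> \<infinity>"
    using f_meas by (intro nn_integral_PInf_AE) measurable
  then have "AE \<alpha> in unit_measure. \<forall>\<eta>>0. \<forall>\<^sub>F k in sequentially.
    max_energy p k (T k) \<alpha> \<le> ennreal (\<eta> * 4 ^ k)"
  proof eventually_elim
    case (elim \<alpha>)
    have fin: "f (Suc k) \<alpha> < top" for k
      using elim by (intro ennreal_suminf_lessD[of "\<lambda>k. f (Suc k) \<alpha>"]) (simp add: less_top)
    define r where "r k = enn2real (f (Suc k) \<alpha>)" for k
    have fr: "f (Suc k) \<alpha> = ennreal (r k)" for k using fin[of k] by (simp add: r_def)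
    have "summable r"
    proof (rule summable_suminf_not_top)
      show "(\<Sum>k. ennreal (r k)) \<noteq> top" unfolding fr[symmetric] using elim by simp
    qed (simp add: r_def)
    then have lim: "r \<longlonglongrightarrow> 0" by (rule summable_LIMSEQ_zero)
    show ?case
    proof (intro allI impI)
      fix \<eta> :: real assume "\<eta> > 0"
      then have "\<forall>\<^sub>F k in sequentially. r k < \<eta>" using order_tendstoD(2)[OF lim] by simp
      then have "\<forall>\<^sub>F k in sequentially. max_energy p (Suc k) (T (Suc k)) \<alpha> \<le> ennreal (\<eta> * 4 ^ Suc k)"
      proof eventually_elim
        case (elim k)
        have "max_energy p (Suc k) (T (Suc k)) \<alpha> = ennreal (4 ^ Suc k * (1 / 4 ^ Suc k)) * max_energy p (Suc k) (T (Suc k)) \<alpha>"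
          by simp
        also have "\<dots> = ennreal (4 ^ Suc k) * f (Suc k) \<alpha>"
          unfolding f_def by (subst ennreal_mult') (simp_all add: mult.assoc)
        also have "\<dots> \<le> ennreal (4 ^ Suc k) * ennreal \<eta>"
          unfolding fr using elim by (intro mult_left_mono ennreal_leI) auto
        also have "\<dots> = ennreal (\<eta> * 4 ^ Suc k)"
          by (subst ennreal_mult'[symmetric]) (simp_all add: mult.commute)
        finally show ?case .
      qed
      then show "\<forall>\<^sub>F k in sequentially. max_energy p k (T k) \<alpha> \<le> ennreal (\<eta> * 4 ^ k)"
        using eventually_sequentially_Suc[of "\<lambda>k. max_energy p k (T k) \<alpha> \<le> ennreal (\<eta> * 4 ^ k)"] by blast
    qed
  qed
  then show ?thesis unfolding T_def by (intro exI[of _ c]) (simp add: c_def)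
qed

section \<open>Deterministic estimates for a fixed \<alpha>\<close>

text \<open>The energy bounds the integral of \<open>P\<^sup>2\<close> over \<open>{0..S}\<close> by
  S \<delta>^2 N^2, hence that of |P| by \<delta> N S. What remains are the term
  \<open>N * S\<^sup>2\<close> from the diagonal and the coincident pairs.\<close>

lemma number_variance_bound:
  assumes x: "\<And>n. n \<ge> 1 \<Longrightarrow> x n = poly p (int n)"
    and S: "0 \<le> S" "S < 1" "S \<le> T"
    and N: "2 ^ j \<le> N" "N < 2 ^ Suc j"
    and Z: "card (coincident_pairs p (Suc N)) \<le> Z"
    and \<delta>: "\<delta> > 0"
    and energy: "max_energy p (Suc j) T \<alpha> \<le> ennreal (\<delta>\<^sup>2 / 4 * 4 ^ Suc j)"
  shows "\<bar>number_variance x N S \<alpha> - real N * S\<bar> \<le> real N * S * (S + 2 * \<delta>) + 2 * real Z * S"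
proof -
  have N0: "real N > 0" using N(1) by (cases "N = 0") auto
  define P where "P s = (\<Sum>\<pi>\<in>diff_pairs p (Suc N). window s (\<alpha> * real_of_int (pair_diff p \<pi>)))" for s
  have P_meas [measurable]: "P \<in> borel_measurable borel" unfolding P_def by measurable
  define L where "L = real (card (diff_pairs p (Suc N)))"
  have P_le: "\<bar>P s\<bar> \<le> L" for s
    unfolding P_def L_def using sum_bounded_above[of "diff_pairs p (Suc N)"
        "\<lambda>\<pi>. \<bar>window s (\<alpha> * real_of_int (pair_diff p \<pi>))\<bar>" 1]
    by (intro order_trans[OF sum_abs]) (simp add: abs_window_le_1)
  have P2_le: "\<bar>(P s)\<^sup>2\<bar> \<le> L\<^sup>2" for s
    using power_mono[OF P_le[of s], of 2] by simp
  have iP: "set_integrable lborel {0..S} P" by (rule set_integrable_bounded[OF P_meas P_le])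
  have iP': "set_integrable lborel {0..S} (\<lambda>s. \<bar>P s\<bar>)"
    by (rule set_integrable_bounded[of _ L]) (use P_le in auto)
  have iP2: "set_integrable lborel {0..S} (\<lambda>s. (P s)\<^sup>2)"
    by (rule set_integrable_bounded[OF _ P2_le]) measurable
  have sq: "(LINT s:{0..S}|lborel. (P s)\<^sup>2) \<le> S * (\<delta>\<^sup>2 * (real N)\<^sup>2)"
  proof -
    have "ennreal (LINT s:{0..S}|lborel. (P s)\<^sup>2) = (\<integral>\<^sup>+ s. ennreal (indicator {0..S} s *\<^sub>R (P s)\<^sup>2) \<partial>lborel)"
      unfolding set_lebesgue_integral_def
      using iP2 by (intro nn_integral_eq_integral[symmetric]) (auto simp: set_integrable_def)
    also have "\<dots> \<le> (\<integral>\<^sup>+ s. ennreal S * (ennreal (max_form p (Suc j) s \<alpha> / s) * indicator {0<..T} s) \<partial>lborel)"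
    proof (intro nn_integral_mono_AE)
      show "AE s in lborel. ennreal (indicator {0..S} s *\<^sub>R (P s)\<^sup>2)
          \<le> ennreal S * (ennreal (max_form p (Suc j) s \<alpha> / s) * indicator {0<..T} s)"
        using AE_lborel_singleton[of 0]
      proof eventually_elim
        fix s :: real assume "s \<noteq> 0"
        show "ennreal (indicator {0..S} s *\<^sub>R (P s)\<^sup>2)
            \<le> ennreal S * (ennreal (max_form p (Suc j) s \<alpha> / s) * indicator {0<..T} s)"
        proof (cases "s \<in> {0..S}")
          case True
          then have s: "0 < s" "s \<le> S" "s \<le> T" using \<open>s \<noteq> 0\<close> S by auto
          have "(P s)\<^sup>2 \<le> max_form p (Suc j) s \<alpha>" unfolding P_def by (rule sum_diff_pairs_sq_le[OF N(2)])
          \<comment> \<open>Here \<open>s \<le> S\<close> enters through 1 \<le> S / s.\<close>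
          also have "\<dots> \<le> S * (max_form p (Suc j) s \<alpha> / s)"
            using s mult_right_mono[OF s(2) max_form_nonneg[of p "Suc j" s \<alpha>]] by (simp add: field_simps)
          finally have "ennreal ((P s)\<^sup>2) \<le> ennreal (S * (max_form p (Suc j) s \<alpha> / s))" by (rule ennreal_leI)
          then show ?thesis using True s S(1) by (simp add: ennreal_mult'[OF S(1), symmetric])
        qed simp
      qed
    qed
    also have "\<dots> = ennreal S * max_energy p (Suc j) T \<alpha>"
      unfolding max_energy_def by (rule nn_integral_cmult) measurable
    also have "\<dots> \<le> ennreal S * ennreal (\<delta>\<^sup>2 / 4 * 4 ^ Suc j)"
      by (intro mult_left_mono energy) simp
    also have "\<dots> = ennreal (S * (\<delta>\<^sup>2 / 4 * 4 ^ Suc j))"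
      using S(1) by (simp add: ennreal_mult')
    finally have "(LINT s:{0..S}|lborel. (P s)\<^sup>2) \<le> S * (\<delta>\<^sup>2 / 4 * 4 ^ Suc j)"
      using S(1) by (subst (asm) ennreal_le_iff) auto
    also have "\<dots> \<le> S * (\<delta>\<^sup>2 * (real N)\<^sup>2)"
    proof (intro mult_left_mono S(1))
      \<comment> \<open>The quarter in the energy hypothesis makes up for the exponent
        \<open>Suc j\<close>, since only \<open>2 ^ j \<le> N\<close> is available.\<close>
      have "(4 :: real) ^ j = (2 ^ j)\<^sup>2" by (simp add: power2_eq_square power_mult_distrib[symmetric])
      also have "\<dots> \<le> (real N)\<^sup>2"
        using of_nat_mono[OF N(1), where 'a = real] by (intro power_mono) simp_all
      finally have "\<delta>\<^sup>2 * 4 ^ j \<le> \<delta>\<^sup>2 * (real N)\<^sup>2" by (intro mult_left_mono) auto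
      then show "\<delta>\<^sup>2 / 4 * 4 ^ Suc j \<le> \<delta>\<^sup>2 * (real N)\<^sup>2" by simp
    qed
    finally show ?thesis .
  qed
  have lin: "\<bar>LINT s:{0..S}|lborel. P s\<bar> \<le> \<delta> * real N * S"
  proof -
    have "\<bar>LINT s:{0..S}|lborel. P s\<bar> \<le> (LINT s:{0..S}|lborel. \<bar>P s\<bar>)"
      using set_integral_norm_bound[OF iP] by simp
    \<comment> \<open>Young's inequality does the work of Cauchy--Schwarz; the weight
      \<open>\<delta> * real N\<close> balances its two terms.\<close>
    also have "\<dots> \<le> (LINT s:{0..S}|lborel. \<delta> * real N / 2 + (P s)\<^sup>2 / (2 * \<delta> * real N))"
    proof (rule set_integral_mono[OF iP'])
      show "set_integrable lborel {0..S} (\<lambda>s. \<delta> * real N / 2 + (P s)\<^sup>2 / (2 * \<delta> * real N))"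
        by (intro set_integral_add(1) set_integrable_divide iP2 set_integrable_bounded[of _ "\<bar>\<delta> * real N / 2\<bar>"]) auto
    next
      fix s
      have "0 \<le> (\<bar>P s\<bar> - \<delta> * real N)\<^sup>2 / (2 * \<delta> * real N)" using \<delta> N0 by simp
      also have "\<dots> = \<delta> * real N / 2 + (P s)\<^sup>2 / (2 * \<delta> * real N) - \<bar>P s\<bar>"
        using \<delta> N0 by (simp add: power2_diff field_simps power2_eq_square)
      finally show "\<bar>P s\<bar> \<le> \<delta> * real N / 2 + (P s)\<^sup>2 / (2 * \<delta> * real N)" by simp
    qed
    also have "\<dots> = \<delta> * real N / 2 * S + (LINT s:{0..S}|lborel. (P s)\<^sup>2) / (2 * \<delta> * real N)"
    proof (subst set_integral_add(2))
      show "set_integrable lborel {0..S} (\<lambda>s. \<delta> * real N / 2)"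
        by (rule set_integrable_bounded[of _ "\<bar>\<delta> * real N / 2\<bar>"]) auto
    qed (use S(1) iP2 in \<open>auto simp: set_integral_const\<close>)
    also have "\<dots> \<le> \<delta> * real N / 2 * S + S * (\<delta>\<^sup>2 * (real N)\<^sup>2) / (2 * \<delta> * real N)"
      using \<delta> N0 by (intro add_left_mono divide_right_mono sq) auto
    also have "\<dots> = \<delta> * real N * S" using \<delta> N0 by (simp add: field_simps power2_eq_square)
    finally show ?thesis .
  qed
  have "number_variance x N S \<alpha> = (real N + 2 * real (card (coincident_pairs p (Suc N)))) * (S - S\<^sup>2) +
      2 * (LINT s:{0..S}|lborel. P s)"
    unfolding P_def by (rule number_variance_decomp[OF S(1,2) x])
  then have "number_variance x N S \<alpha> - real N * S =
      2 * (LINT s:{0..S}|lborel. P s) + 2 * real (card (coincident_pairs p (Suc N))) * (S - S\<^sup>2) - real N * S\<^sup>2"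
    by (simp add: algebra_simps)
  moreover have "0 \<le> 2 * real (card (coincident_pairs p (Suc N))) * (S - S\<^sup>2)"
    using S mult_left_mono[of S 1 S] by (intro mult_nonneg_nonneg) (auto simp: power2_eq_square)
  moreover have "2 * real (card (coincident_pairs p (Suc N))) * (S - S\<^sup>2) \<le> 2 * real Z * S"
    using S Z mult_left_mono[of S 1 S] by (intro mult_mono) (auto simp: power2_eq_square)
  moreover have "0 \<le> real N * S\<^sup>2" by simp
  moreover have "real N * S * (S + 2 * \<delta>) = real N * S\<^sup>2 + 2 * (\<delta> * real N * S)"
    by (simp add: algebra_simps power2_eq_square)
  moreover have "0 \<le> 2 * real Z * S" using S by simp
  ultimately show ?thesis using lin by linarith
qed

lemma number_variance_asymptotic:
  fixes p :: "int poly"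
  assumes "degree p \<ge> 2" and x: "\<And>n. n \<ge> 1 \<Longrightarrow> x n = poly p (int n)"
    and c: "c > 0"
    and energy: "\<And>\<eta>. \<eta> > 0 \<Longrightarrow> \<forall>\<^sub>F k in sequentially. max_energy p k ((4 / real k) ^ c) \<alpha> \<le> ennreal (\<eta> * 4 ^ k)"
    and \<epsilon>: "\<epsilon> > 0"
  shows "\<forall>\<^sub>F N in sequentially. \<forall>S\<in>{0..ln (real N) powr (- real c)}.
    \<bar>number_variance x N S \<alpha> - real N * S\<bar> \<le> \<epsilon> * (real N * S)"
proof -
  obtain Z where Z: "\<And>M. card (coincident_pairs p M) \<le> Z"
    using card_coincident_pairs_bounded[OF assms(1)] by blast
  \<comment> \<open>The error budget: S < \<epsilon>/4 and 2\<delta> = \<epsilon>/4 add up to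
    \<epsilon>/2, and for large \<open>N\<close> the coincident pairs cost at most another
    \<epsilon>/4.\<close>
  define \<delta> where "\<delta> = \<epsilon> / 8"
  have \<delta>: "\<delta> > 0" using \<epsilon> by (simp add: \<delta>_def)
  define T where "T k = (4 / real k) ^ c" for k
  have "(\<lambda>k. 4 / real k) \<longlonglongrightarrow> 0" by (rule lim_const_over_n)
  then have "T \<longlonglongrightarrow> 0 ^ c" unfolding T_def by (rule tendsto_power)
  then have "T \<longlonglongrightarrow> 0" by (simp only: zero_power[OF c])
  then have "\<forall>\<^sub>F k in sequentially. T k < min (\<epsilon> / 4) 1" using \<epsilon> by (intro order_tendstoD) auto
  moreover have "\<forall>\<^sub>F k in sequentially. max_energy p k (T k) \<alpha> \<le> ennreal (\<delta>\<^sup>2 / 4 * 4 ^ k)"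
    unfolding T_def using \<delta> by (intro energy) simp
  ultimately have "\<forall>\<^sub>F k in sequentially. T k < min (\<epsilon> / 4) 1 \<and> max_energy p k (T k) \<alpha> \<le> ennreal (\<delta>\<^sup>2 / 4 * 4 ^ k)"
    by (rule eventually_conj)
  then obtain k0 where k0: "\<And>k. k \<ge> k0 \<Longrightarrow> T k < min (\<epsilon> / 4) 1"
      "\<And>k. k \<ge> k0 \<Longrightarrow> max_energy p k (T k) \<alpha> \<le> ennreal (\<delta>\<^sup>2 / 4 * 4 ^ k)"
    unfolding eventually_sequentially by blast
  have "\<bar>number_variance x N S \<alpha> - real N * S\<bar> \<le> \<epsilon> * (real N * S)"
    if N: "N \<ge> max (2 ^ Suc k0) (nat \<lceil>8 * real Z / \<epsilon>\<rceil>)" and S: "S \<in> {0..ln (real N) powr (- real c)}" for N S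
  proof -
    have N1: "N \<ge> 2 ^ Suc k0" and N2: "real N \<ge> 8 * real Z / \<epsilon>" using N by linarith+
    have "N \<ge> 1" using N1 by (meson one_le_numeral one_le_power order_trans)
    then obtain j where j: "2 ^ j \<le> N" "N < 2 ^ Suc j" using ex_power_ivl1[of 2 N] by auto
    have "(2 :: nat) ^ Suc k0 < 2 ^ Suc j" using N1 j(2) by (rule le_less_trans)
    then have jk: "Suc k0 < Suc j" by (rule power_less_imp_less_exp[rotated]) simp
    \<comment> \<open>This explains the 4 in \<open>T\<close>: the logarithm of \<open>N\<close> is
      at least a quarter of the dyadic level \<open>Suc j\<close>, so the prescribed range of
      \<open>S\<close> lies below \<open>T (Suc j)\<close>.\<close>
    have "real (Suc j) / 4 \<le> real j * (2 / 3)" using jk by simp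
    also have "\<dots> \<le> real j * ln 2" by (intro mult_left_mono ln2_ge_two_thirds) simp
    also have "\<dots> = ln (2 ^ j)" by (simp add: ln_realpow)
    also have "\<dots> \<le> ln (real N)"
      using of_nat_mono[OF j(1), where 'a = real] \<open>N \<ge> 1\<close> by (subst ln_le_cancel_iff) simp_all
    finally have lnN: "real (Suc j) / 4 \<le> ln (real N)" .
    have "S \<le> ln (real N) powr (- real c)" using S by simp
    also have "\<dots> \<le> (real (Suc j) / 4) powr (- real c)"
      using lnN by (intro powr_mono2') auto
    also have "\<dots> = T (Suc j)"
      by (simp add: T_def powr_minus powr_realpow power_divide field_simps)
    finally have ST: "S \<le> T (Suc j)" .
    have Tj: "T (Suc j) < min (\<epsilon> / 4) 1" "max_energy p (Suc j) (T (Suc j)) \<alpha> \<le> ennreal (\<delta>\<^sup>2 / 4 * 4 ^ Suc j)"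
      using k0[of "Suc j"] jk by (simp_all only: Suc_less_eq less_imp_le less_SucI)
    have S0: "S \<ge> 0" using S by simp
    have "\<bar>number_variance x N S \<alpha> - real N * S\<bar> \<le> real N * S * (S + 2 * \<delta>) + 2 * real Z * S"
      using ST Tj S0 by (intro number_variance_bound[OF x _ _ ST j Z \<delta> Tj(2)]) auto
    also have "real N * S * (S + 2 * \<delta>) \<le> real N * S * (\<epsilon> / 2)"
      using S0 ST Tj(1) by (intro mult_left_mono) (auto simp: \<delta>_def)
    also have "2 * real Z * S \<le> real N * (\<epsilon> / 4) * S"
      using N2 \<epsilon> S0 by (intro mult_right_mono) (simp_all add: field_simps)
    also have "real N * S * (\<epsilon> / 2) + real N * (\<epsilon> / 4) * S \<le> \<epsilon> * (real N * S)"
      using \<epsilon> S0 by (simp add: field_simps)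
    finally show ?thesis by simp
  qed
  then show ?thesis unfolding eventually_sequentially by blast
qed

theorem theorem1:
  fixes p :: "int poly" and x :: "nat \<Rightarrow> int"
  assumes "degree p \<ge> 2"
    and "\<And>n. n \<ge> 1 \<Longrightarrow> x n = poly p (int n)"
  shows "\<exists>c>0. AE \<alpha> in lebesgue. \<alpha> \<in> {0..1} \<longrightarrow>
    (\<forall>\<epsilon>>0. \<forall>\<^sub>F N in sequentially. \<forall>S\<in>{0..ln (real N) powr (- c)}.
        \<bar>number_variance x N S \<alpha> - real N * S\<bar> \<le> \<epsilon> * (real N * S)) \<and>
    (\<lambda>N. SUP S\<in>{0<..ln (real N) powr (- c)}.
        ereal (\<bar>number_variance x N S \<alpha> - real N * S\<bar> / (real N * S))) \<longlonglongrightarrow> 0"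
proof -
  obtain c :: nat where c: "c > 0" and ae: "AE \<alpha> in unit_measure. \<forall>\<eta>>0. \<forall>\<^sub>F k in sequentially.
      max_energy p k ((4 / real k) ^ c) \<alpha> \<le> ennreal (\<eta> * 4 ^ k)"
    using max_energy_small[OF assms(1)] by blast
  let ?V = "\<lambda>N S \<alpha>. \<bar>number_variance x N S \<alpha> - real N * S\<bar>"
  have sup: "(\<lambda>N. SUP S\<in>{0<..ln (real N) powr (- real c)}. ereal (?V N S \<alpha> / (real N * S))) \<longlonglongrightarrow> 0"
    if V: "\<forall>\<epsilon>>0. \<forall>\<^sub>F N in sequentially. \<forall>S\<in>{0..ln (real N) powr (- real c)}. ?V N S \<alpha> \<le> \<epsilon> * (real N * S)" for \<alpha>
  proof (rule order_tendstoI)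
    fix a :: ereal assume a: "a < 0"
    \<comment> \<open>The right endpoint of the range is a witness. From \<open>N = 2\<close> on the
      range is nonempty, whereas the supremum of the empty set would be
      \<open>- \<infinity>\<close>.\<close>
    show "\<forall>\<^sub>F N in sequentially. a < (SUP S\<in>{0<..ln (real N) powr (- real c)}. ereal (?V N S \<alpha> / (real N * S)))"
      using eventually_ge_at_top[of 2]
    proof eventually_elim
      case (elim N)
      let ?S = "ln (real N) powr (- real c)"
      have "?S > 0" using elim by simp
      then have "ereal (?V N ?S \<alpha> / (real N * ?S)) \<le> (SUP S\<in>{0<..?S}. ereal (?V N S \<alpha> / (real N * S)))"
        by (intro SUP_upper) simp
      moreover have "0 \<le> ereal (?V N ?S \<alpha> / (real N * ?S))" using \<open>?S > 0\<close> by simp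
      ultimately show ?case using a by (meson less_le_trans order_trans)
    qed
  next
    fix a :: ereal assume "0 < a"
    then obtain \<epsilon> where \<epsilon>: "0 < ereal \<epsilon>" "ereal \<epsilon> < a" using ereal_dense2[of 0 a] by (metis zero_ereal_def)
    then have "\<forall>\<^sub>F N in sequentially. \<forall>S\<in>{0..ln (real N) powr (- real c)}. ?V N S \<alpha> \<le> \<epsilon> * (real N * S)"
      using V by simp
    then show "\<forall>\<^sub>F N in sequentially. (SUP S\<in>{0<..ln (real N) powr (- real c)}. ereal (?V N S \<alpha> / (real N * S))) < a"
      using eventually_ge_at_top[of 1]
    proof eventually_elim
      case (elim N)
      have "(SUP S\<in>{0<..ln (real N) powr (- real c)}. ereal (?V N S \<alpha> / (real N * S))) \<le> ereal \<epsilon>"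
      proof (rule SUP_least)
        fix S assume S: "S \<in> {0<..ln (real N) powr (- real c)}"
        then have "?V N S \<alpha> \<le> \<epsilon> * (real N * S)" using elim(1) by auto
        moreover have "real N * S > 0" using S elim(2) by simp
        ultimately show "ereal (?V N S \<alpha> / (real N * S)) \<le> ereal \<epsilon>" by (simp add: divide_le_eq)
      qed
      then show ?case using \<epsilon>(2) by (rule le_less_trans)
    qed
  qed
  have "AE \<alpha> in lborel. \<alpha> \<in> {0..1} \<longrightarrow> (\<forall>\<eta>>0. \<forall>\<^sub>F k in sequentially.
      max_energy p k ((4 / real k) ^ c) \<alpha> \<le> ennreal (\<eta> * 4 ^ k))"
    using ae unfolding unit_measure_def by (subst (asm) AE_restrict_space_iff) auto
  then have "AE \<alpha> in lborel. \<alpha> \<in> {0..1} \<longrightarrow>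
    (\<forall>\<epsilon>>0. \<forall>\<^sub>F N in sequentially. \<forall>S\<in>{0..ln (real N) powr (- real c)}. ?V N S \<alpha> \<le> \<epsilon> * (real N * S)) \<and>
    (\<lambda>N. SUP S\<in>{0<..ln (real N) powr (- real c)}. ereal (?V N S \<alpha> / (real N * S))) \<longlonglongrightarrow> 0"
  proof eventually_elim
    case (elim \<alpha>)
    show ?case
    proof
      assume \<alpha>: "\<alpha> \<in> {0..1}"
      have *: "\<forall>\<epsilon>>0. \<forall>\<^sub>F N in sequentially. \<forall>S\<in>{0..ln (real N) powr (- real c)}. ?V N S \<alpha> \<le> \<epsilon> * (real N * S)"
        using number_variance_asymptotic[OF assms c, of \<alpha>] elim \<alpha> by blast
      with sup[OF *] show "(\<forall>\<epsilon>>0. \<forall>\<^sub>F N in sequentially. \<forall>S\<in>{0..ln (real N) powr (- real c)}. ?V N S \<alpha> \<le> \<epsilon> * (real N * S)) \<and>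
        (\<lambda>N. SUP S\<in>{0<..ln (real N) powr (- real c)}. ereal (?V N S \<alpha> / (real N * S))) \<longlonglongrightarrow> 0" by blast
    qed
  qed
  from AE_completion[OF this] show ?thesis using c by (intro exI[of _ "real c"]) simp
qed

end
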